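(* Let $\mathbf{Sr}(2)$ be the variety generated by all semirings of order two. Then $\mathbf{Sr}(2)$ is the class of all semirings satisfying the following ten identities: $$x^2y\approx xy,\qquad xy^2\approx xy,\qquad xyzt\approx xzyt,\qquad (xy)^2\approx xy,$$ $$x+yz\approx x+yz+2xz,\qquad x+yz\approx x+yz+2yx,\qquad x+yz\approx x+yz+2x^2,$$ $$x+yz\approx x+yz+2xyz,\qquad x+yz\approx x+yz+2yzx,\qquad x+y\approx x+3y.$$
   Context: A semiring is an algebra $(S,+,\cdot)$ such that $(S,+)$ is a commutative semigroup, $(S,\cdot)$ is a semigroup, and the distributive laws $x(y+z)\approx xy+xz$ and $(y+z)x\approx yx+zx$ hold (no additive or multiplicative identity element is required). For a positive integer $n$, $nw$ denotes the sum of $n$ copies of $w$. Up to isomorphism there are exactly ten semirings with two elements, all with underlying set $\{0,1\}$: with addition $a+b=\max(a,b)$: $L_2$ ($ab=a$), $R_2$ ($ab=b$), $M_2$ ($ab=\max(a,b)$), $D_2$ ($ab=\min(a,b)$), $N_2$ ($ab=0$ always), $T_2$ ($ab=1$ always); with addition $a+b=0$ always: $Z_2$ ($ab=0$ always), $W_2$ ($ab=\min(a,b)$); with addition modulo 2: $Z_7$ ($ab=0$ always), $Z_8$ ($ab=\min(a,b)$). $\mathbf{Sr}(2)$ denotes the semiring variety generated by these ten semirings. *)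

theory Defs
  imports "HOL-Library.FuncSet"
begin

text \<open>
  Algebras of type (2,2) with an explicit carrier set. Neither an additive nor a
  multiplicative identity is assumed, so the semirings of HOL-Algebra do not apply.
\<close>

record 'a alg =
  carrier :: "'a set"
  plus :: "'a \<Rightarrow> 'a \<Rightarrow> 'a"  (infixl "\<oplus>\<index>" 65)
  times :: "'a \<Rightarrow> 'a \<Rightarrow> 'a"  (infixl "\<otimes>\<index>" 70)

definition is_semiring :: "'a alg \<Rightarrow> bool" where
  "is_semiring S \<longleftrightarrow>
     carrier S \<noteq> {} \<and>
     (\<forall>x\<in>carrier S. \<forall>y\<in>carrier S. x \<oplus>\<^bsub>S\<^esub> y \<in> carrier S \<and> x \<otimes>\<^bsub>S\<^esub> y \<in> carrier S) \<and>
     (\<forall>x\<in>carrier S. \<forall>y\<in>carrier S. x \<oplus>\<^bsub>S\<^esub> y = y \<oplus>\<^bsub>S\<^esub> x) \<and>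
     (\<forall>x\<in>carrier S. \<forall>y\<in>carrier S. \<forall>z\<in>carrier S.
        (x \<oplus>\<^bsub>S\<^esub> y) \<oplus>\<^bsub>S\<^esub> z = x \<oplus>\<^bsub>S\<^esub> (y \<oplus>\<^bsub>S\<^esub> z) \<and>
        (x \<otimes>\<^bsub>S\<^esub> y) \<otimes>\<^bsub>S\<^esub> z = x \<otimes>\<^bsub>S\<^esub> (y \<otimes>\<^bsub>S\<^esub> z) \<and>
        x \<otimes>\<^bsub>S\<^esub> (y \<oplus>\<^bsub>S\<^esub> z) = x \<otimes>\<^bsub>S\<^esub> y \<oplus>\<^bsub>S\<^esub> x \<otimes>\<^bsub>S\<^esub> z \<and>
        (y \<oplus>\<^bsub>S\<^esub> z) \<otimes>\<^bsub>S\<^esub> x = y \<otimes>\<^bsub>S\<^esub> x \<oplus>\<^bsub>S\<^esub> z \<otimes>\<^bsub>S\<^esub> x)"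

definition alg_hom :: "'a alg \<Rightarrow> 'b alg \<Rightarrow> ('a \<Rightarrow> 'b) set" where
  "alg_hom A B = {f \<in> carrier A \<rightarrow> carrier B. \<forall>x\<in>carrier A. \<forall>y\<in>carrier A.
     f (x \<oplus>\<^bsub>A\<^esub> y) = f x \<oplus>\<^bsub>B\<^esub> f y \<and> f (x \<otimes>\<^bsub>A\<^esub> y) = f x \<otimes>\<^bsub>B\<^esub> f y}"

definition hom_image :: "'a alg \<Rightarrow> 'b alg \<Rightarrow> bool" where
  "hom_image A B \<longleftrightarrow> (\<exists>f\<in>alg_hom A B. f ` carrier A = carrier B)"

definition alg_iso :: "'a alg \<Rightarrow> 'b alg \<Rightarrow> bool" where
  "alg_iso A B \<longleftrightarrow> (\<exists>f\<in>alg_hom A B. bij_betw f (carrier A) (carrier B))"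

definition subuniverse :: "'a set \<Rightarrow> 'a alg \<Rightarrow> bool" where
  "subuniverse H A \<longleftrightarrow> H \<noteq> {} \<and> H \<subseteq> carrier A \<and>
     (\<forall>x\<in>H. \<forall>y\<in>H. x \<oplus>\<^bsub>A\<^esub> y \<in> H \<and> x \<otimes>\<^bsub>A\<^esub> y \<in> H)"

definition direct_product :: "'i set \<Rightarrow> ('i \<Rightarrow> 'a alg) \<Rightarrow> ('i \<Rightarrow> 'a) alg" where
  "direct_product I F =
     \<lparr>carrier = (\<Pi>\<^sub>E i\<in>I. carrier (F i)),
      plus = (\<lambda>f g. \<lambda>i\<in>I. f i \<oplus>\<^bsub>F i\<^esub> g i),
      times = (\<lambda>f g. \<lambda>i\<in>I. f i \<otimes>\<^bsub>F i\<^esub> g i)\<rparr>"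

text \<open>
  A type \<open>'u\<close> plays the role of a universe: a variety within \<open>'u\<close> is a class of semirings
  carried by subsets of \<open>'u\<close> that is closed under homomorphic images, subsemirings and those
  direct products that have an isomorphic copy in \<open>'u\<close>. Indexing by subsets of \<open>'u\<close> is no
  restriction, since at most \<open>|'u|\<close> factors of such a product have more than one element.
\<close>

definition variety :: "'u alg set \<Rightarrow> bool" where
  "variety V \<longleftrightarrow>
     (\<forall>A\<in>V. is_semiring A) \<and>
     (\<forall>A\<in>V. \<forall>B. hom_image A B \<longrightarrow> B \<in> V) \<and>
     (\<forall>A\<in>V. \<forall>H. subuniverse H A \<longrightarrow> A\<lparr>carrier := H\<rparr> \<in> V) \<and>
     (\<forall>(I :: 'u set) F B. (\<forall>i\<in>I. F i \<in> V) \<and> alg_iso (direct_product I F) B \<longrightarrow> B \<in> V)"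

definition variety_generated_by :: "'u alg set \<Rightarrow> 'u alg set" where
  "variety_generated_by K = \<Inter>{V. variety V \<and> K \<subseteq> V}"

text \<open>
  No fixed universe \<open>'u\<close> contains all the products needed to generate its own semirings: an
  infinite product of semirings of order two is uncountable, for example. The semirings over
  \<open>'a\<close> in the generated variety are therefore obtained by generating within a universe twice
  exponentially larger than \<open>'a\<close>; the summand \<open>nat\<close> makes it infinite.
\<close>

definition Sr2 :: "'a alg set" where
  "Sr2 = {S. \<exists>T \<in> variety_generated_by
                    {A :: (('a + nat) set set) alg. is_semiring A \<and> card (carrier A) = 2}.
             alg_iso T S}"

end

theory Submission
  imports Defs
begin

text \<open>
  The inclusion from left to right holds because identities are inherited by homomorphic images,
  subalgebras and products (\<open>variety_models\<close>), and the ten identities hold in all semirings of order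
  two, as one checks on operation tables over the truth values (\<open>two_element_laws\<close>).

  The converse rests on completeness: two polynomials that agree in the ten two-element semirings
  under all valuations have the same value in every semiring that satisfies the ten identities
  (\<open>equal_on_tables_imp_eq\<close>). Three facts carry the proof.

  First, the multiplicative identities make the value of a word of length at least two depend only on
  its first letter, its last letter and its set of letters (\<open>product_eqI\<close>).

  Second, say that \<open>e\<close> absorbs \<open>a\<close> if \<open>e + 2a = e\<close>. A sum of at least two words absorbs its own words, and
  the five identities for \<open>x + yz\<close> produce further absorbed words. They produce all the words that the
  six semirings with addition \<open>max\<close> permit (\<open>absorbs_word_product\<close>). Consequently, if \<open>P\<close> and \<open>Q\<close> agree in
  these semirings, each of the two absorbs the words of the other.

  Third, two absorbed products with the same letters may replace each other as summands
  (\<open>exchange_product\<close>), because the square of a sum that is a product equals the sum. Only the parity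
  of the number of words with a given set of letters, and of each single letter, remains to be compared,
  and these parities are what the two semirings with addition modulo 2 compute.

  Sums of at least two words are told apart from single words by \<open>W\<^sub>2\<close>, and for single words the normal
  form suffices.

  By completeness, a semiring \<open>S\<close> that satisfies the identities is a homomorphic image of the algebra of
  term functions in the variables \<open>S\<close>, which is a subalgebra of a product of two-element semirings with
  one factor for each table and each valuation of the variables. Tables and valuations are coded by
  sets over \<open>'a + nat\<close> and elements of the product by sets of such codes, so that the product fits in
  the universe used to define \<open>Sr2\<close> (\<open>sr2_laws_imp_Sr2\<close>).
\<close>

section \<open>Polynomials as lists of words\<close>
fun fold1 :: "('a \<Rightarrow> 'a \<Rightarrow> 'a) \<Rightarrow> 'a list \<Rightarrow> 'a" where
  "fold1 f [] = undefined"
| "fold1 f [x] = x"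
| "fold1 f (x # y # ys) = f x (fold1 f (y # ys))"

lemma fold1_Cons: "xs \<noteq> [] \<Longrightarrow> fold1 f (x # xs) = f x (fold1 f xs)"
  by (cases xs) auto

lemma fold1_append_foldr: "ys \<noteq> [] \<Longrightarrow> fold1 f (xs @ ys) = foldr f xs (fold1 f ys)"
  by (induction xs) (auto simp: fold1_Cons)

lemma fold1_append:
  assumes "\<And>x y z. f (f x y) z = f x (f y z)" "xs \<noteq> []" "ys \<noteq> []"
  shows "fold1 f (xs @ ys) = f (fold1 f xs) (fold1 f ys)"
  using assms(2) by (induction xs rule: list_nonempty_induct) (auto simp: fold1_Cons assms)

lemma fold1_closed:
  assumes "\<And>x y. x \<in> C \<Longrightarrow> y \<in> C \<Longrightarrow> f x y \<in> C" "xs \<noteq> []" "set xs \<subseteq> C"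
  shows "fold1 f xs \<in> C"
  using assms(2,3) by (induction xs rule: list_nonempty_induct) (auto simp: fold1_Cons assms(1))

text \<open>
  A word is a nonempty list of letters and a polynomial a nonempty list of words; by distributivity
  every semiring term is a polynomial. Semirings here may lack \<open>0\<close> and \<open>1\<close>, so sums and products
  are nonempty folds, and the value takes both operations as parameters in order to serve the
  two-element semirings and an arbitrary one alike.
\<close>
type_synonym 'x poly = "'x list list"

definition is_poly :: "'x poly \<Rightarrow> bool" where
  "is_poly P \<longleftrightarrow> P \<noteq> [] \<and> [] \<notin> set P"

definition poly_value ::
  "('a \<Rightarrow> 'a \<Rightarrow> 'a) \<Rightarrow> ('a \<Rightarrow> 'a \<Rightarrow> 'a) \<Rightarrow> ('x \<Rightarrow> 'a) \<Rightarrow> 'x poly \<Rightarrow> 'a" where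
  "poly_value p t v P = fold1 p (map (\<lambda>w. fold1 t (map v w)) P)"

definition poly_mult :: "'x poly \<Rightarrow> 'x poly \<Rightarrow> 'x poly" where
  "poly_mult P Q = concat (map (\<lambda>a. map ((@) a) Q) P)"

lemma is_poly_append: "is_poly P \<Longrightarrow> is_poly Q \<Longrightarrow> is_poly (P @ Q)"
  by (auto simp: is_poly_def)

lemma is_poly_mult: "is_poly P \<Longrightarrow> is_poly Q \<Longrightarrow> is_poly (poly_mult P Q)"
  by (cases P) (auto simp: is_poly_def poly_mult_def)

context semiring
begin

lemma poly_value_append:
  assumes "is_poly P" "is_poly Q"
  shows "poly_value (+) (*) v (P @ Q) = poly_value (+) (*) v P + poly_value (+) (*) v Q"
  using assms by (simp add: poly_value_def is_poly_def fold1_append add.assoc)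

lemma fold1_times_append:
  assumes "a \<noteq> []" "b \<noteq> []"
  shows "fold1 (*) (a @ b) = fold1 (*) a * fold1 (*) b"
  using assms by (simp add: fold1_append mult.assoc)

lemma poly_value_mult:
  assumes "is_poly P" "is_poly Q"
  shows "poly_value (+) (*) v (poly_mult P Q) = poly_value (+) (*) v P * poly_value (+) (*) v Q"
proof -
  have row: "poly_value (+) (*) v (map ((@) a) Q) = fold1 (*) (map v a) * poly_value (+) (*) v Q"
    if "a \<noteq> []" for a
  proof -
    have "Q \<noteq> []" "[] \<notin> set Q"
      using assms(2) by (auto simp: is_poly_def)
    then show ?thesis
      by (induction Q rule: list_nonempty_induct)
        (auto simp: poly_value_def fold1_Cons fold1_times_append that distrib_left)
  qed
  have "P \<noteq> []" "[] \<notin> set P"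
    using assms(1) by (auto simp: is_poly_def)
  then show ?thesis
  proof (induction P rule: list_nonempty_induct)
    case (single a)
    then have "a \<noteq> []" by auto
    then show ?case
      using row[of a] by (simp add: poly_mult_def) (simp add: poly_value_def)
  next
    case (cons a P)
    then have a: "a \<noteq> []" and P: "is_poly P"
      by (auto simp: is_poly_def)
    have "poly_value (+) (*) v (poly_mult (a # P) Q)
        = poly_value (+) (*) v (map ((@) a) Q @ poly_mult P Q)"
      by (simp add: poly_mult_def)
    also have "\<dots> = poly_value (+) (*) v (map ((@) a) Q) + poly_value (+) (*) v (poly_mult P Q)"
      using a assms(2) P by (intro poly_value_append is_poly_mult) (auto simp: is_poly_def)
    also have "\<dots> = poly_value (+) (*) v (a # P) * poly_value (+) (*) v Q"
      using cons row[OF a] P by (simp add: poly_value_def fold1_Cons is_poly_def distrib_right)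
    finally show ?case .
  qed
qed

end

section \<open>Products under the ten identities\<close>
class sr2 = semiring +
  assumes left_square: "x * x * y = x * y"
    and right_square: "x * y * y = x * y"
    and middle_commute: "x * y * z * t = x * z * y * t"
    and product_idem: "(x * y) * (x * y) = x * y"
    and absorb_right: "x + y * z = x + y * z + (x * z + x * z)"
    and absorb_left: "x + y * z = x + y * z + (y * x + y * x)"
    and absorb_square: "x + y * z = x + y * z + (x * x + x * x)"
    and absorb_mult_right: "x + y * z = x + y * z + (x * y * z + x * y * z)"
    and absorb_mult_left: "x + y * z = x + y * z + (y * z * x + y * z * x)"
    and add_triple: "x + y = x + (y + y + y)"
begin

text \<open>
  Products are written as \<open>h * foldr (*) m t\<close> with first factor \<open>h\<close>, last factor \<open>t\<close> and middle \<open>m\<close>.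
  The law \<open>xyzt = xzyt\<close> lets factors move only while they are shielded on both sides, which is why
  \<open>h\<close> and \<open>t\<close> stay in place here and in the following lemmas.
\<close>
lemma foldr_pull: "h * foldr (*) m (z * t) = h * (z * foldr (*) m t)"
proof (induction m arbitrary: h)
  case (Cons a m)
  have "h * foldr (*) (a # m) (z * t) = h * (a * (z * foldr (*) m t))"
    using Cons[of a] by simp
  also have "\<dots> = h * (z * (a * foldr (*) m t))"
    using middle_commute[of h a z "foldr (*) m t"] by (simp add: mult.assoc)
  finally show ?case by simp
qed simp

lemma foldr_commute: "h * foldr (*) (m @ m') t = h * foldr (*) (m' @ m) t"
proof (induction m arbitrary: h)
  case (Cons a m)
  have "h * foldr (*) ((a # m) @ m') t = h * (a * foldr (*) (m' @ m) t)"
    using Cons[of a] by simp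
  also have "\<dots> = h * foldr (*) (m' @ a # m) t"
    using foldr_pull[of h m' a] by simp
  finally show ?case .
qed simp

text \<open>
  A repeated factor is moved next to its twin, where it is swallowed: next to \<open>h\<close> by \<open>xxy = xy\<close>, next
  to \<open>t\<close> by \<open>xyy = xy\<close>, and next to a middle factor by \<open>xxy = xy\<close> again, with that factor in the role
  of \<open>h\<close>.
\<close>
lemma foldr_insert:
  assumes "z \<in> insert h (insert t (set m))"
  shows "h * (z * foldr (*) m t) = h * foldr (*) m t"
  using assms
proof (induction m arbitrary: h)
  case Nil
  then show ?case
    using left_square right_square by (auto simp: mult.assoc)
next
  case (Cons a m)
  show ?case
  proof (cases "z = h")
    case True
    then show ?thesis using left_square by (simp add: mult.assoc)
  next
    case False
    then have "a * (z * foldr (*) m t) = a * foldr (*) m t"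
      using Cons.prems by (intro Cons.IH) auto
    then have "h * (a * (z * foldr (*) m t)) = h * foldr (*) (a # m) t"
      by simp
    then show ?thesis
      using middle_commute[of h a z "foldr (*) m t"] by (simp add: mult.assoc)
  qed
qed

lemma foldr_absorb:
  assumes "set m' \<subseteq> insert h (insert t (set m))"
  shows "h * foldr (*) (m' @ m) t = h * foldr (*) m t"
  using assms
proof (induction m')
  case (Cons z m')
  have "h * (z * foldr (*) (m' @ m) t) = h * foldr (*) (m' @ m) t"
    using Cons.prems by (intro foldr_insert) auto
  then show ?case
    using Cons by simp
qed simp

text \<open>
  The normal form of words: both middles may be enlarged to the union of the two middles, because
  every inserted letter already occurs in the word.
\<close>
lemma product_eqI:
  assumes "2 \<le> length a" "2 \<le> length b" "hd a = hd b" "last a = last b" "set a = set b"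
  shows "fold1 (*) a = fold1 (*) b"
proof -
  have split: "\<exists>h m t. c = h # m @ [t]" if "2 \<le> length c" for c :: "'a list"
  proof -
    have "c = hd c # butlast (tl c) @ [last c]"
      using that by (cases c; cases "tl c") auto
    then show ?thesis by blast
  qed
  obtain h m t where a: "a = h # m @ [t]" using split assms(1) by blast
  obtain m' where b: "b = h # m' @ [t]" using split[OF assms(2)] assms(3,4) a by auto
  have fold: "fold1 (*) (h # n @ [t]) = h * foldr (*) n t" for n
    using fold1_append_foldr[of "[t]" "(*)" "h # n"] by simp
  have "h * foldr (*) m t = h * foldr (*) (m' @ m) t"
    using assms(5) a b by (intro foldr_absorb[symmetric]) auto
  also have "\<dots> = h * foldr (*) (m @ m') t"
    by (rule foldr_commute)
  also have "\<dots> = h * foldr (*) m' t"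
    using assms(5) a b by (intro foldr_absorb) auto
  finally show ?thesis
    by (simp add: a b fold)
qed

lemma hd_times_product:
  assumes "2 \<le> length a"
  shows "hd a * fold1 (*) a = fold1 (*) a"
proof -
  have "a \<noteq> []" using assms by auto
  then have "fold1 (*) (hd a # a) = fold1 (*) a"
    using assms by (intro product_eqI) (auto simp: insert_absorb)
  then show ?thesis
    using \<open>a \<noteq> []\<close> by (simp add: fold1_Cons)
qed

lemma product_times_last:
  assumes "2 \<le> length a"
  shows "fold1 (*) a * last a = fold1 (*) a"
proof -
  have "a \<noteq> []" using assms by auto
  then have "fold1 (*) (a @ [last a]) = fold1 (*) a"
    using assms by (intro product_eqI) (auto simp: insert_absorb)
  then show ?thesis
    using \<open>a \<noteq> []\<close> by (simp add: fold1_times_append)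
qed

section \<open>Absorbed words\<close>

text \<open>
  All words of a sum \<open>e\<close> with at least two summands are absorbed, by \<open>x + y = x + 3y\<close>, and so are all
  the words that the absorption laws derive from them. Thus the set of absorbed words is a larger and
  more canonical substitute for the set of words of \<open>e\<close>.
\<close>
definition absorbs :: "'a \<Rightarrow> 'a \<Rightarrow> bool" where
  "absorbs e a \<longleftrightarrow> e + (a + a) = e"

lemma absorbs_add_left: "absorbs e a \<Longrightarrow> absorbs (d + e) a"
  by (simp add: absorbs_def add.assoc)

lemma absorbs_add_right: "absorbs e a \<Longrightarrow> absorbs (e + d) a"
  using absorbs_add_left[of e a d] by (simp add: add.commute)

lemma absorbs_summand: "absorbs (d + a) a"
  using add_triple[of d a, symmetric] by (simp add: absorbs_def add.assoc)

lemma absorbs_add: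
  assumes "absorbs e a" "absorbs e b"
  shows "absorbs e (a + b)"
proof -
  have "e + (a + b + (a + b)) = e + (a + a) + (b + b)"
    by (simp add: ac_simps)
  then show ?thesis using assms by (simp add: absorbs_def)
qed

text \<open>
  The absorption laws have the form \<open>c = c + 2d\<close>; this is how they produce new absorbed elements.
\<close>
lemma absorbs_consequence:
  assumes "absorbs e c" "c = c + (d + d)"
  shows "absorbs e d"
proof -
  have "c + c + (d + d) = c + c"
    using assms(2) by (metis add.assoc)
  then show ?thesis
    using assms(1) by (metis absorbs_def add.assoc)
qed

definition absorbs_word :: "'a \<Rightarrow> 'a list \<Rightarrow> bool" where
  "absorbs_word e w \<longleftrightarrow> w \<noteq> [] \<and> absorbs e (fold1 (*) w)"

lemma absorbs_word_rules:
  assumes "absorbs_word e a" "absorbs_word e (b @ c)" "b \<noteq> []" "c \<noteq> []"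
  shows "absorbs_word e (a @ c)" "absorbs_word e (b @ a)" "absorbs_word e (a @ a)"
    "absorbs_word e (a @ b @ c)" "absorbs_word e ((b @ c) @ a)"
proof -
  have a: "a \<noteq> []" using assms(1) by (simp add: absorbs_word_def)
  let ?a = "fold1 (*) a" and ?b = "fold1 (*) b" and ?c = "fold1 (*) c"
  have e: "absorbs e (?a + ?b * ?c)"
    using assms by (intro absorbs_add) (auto simp: absorbs_word_def fold1_times_append)
  show "absorbs_word e (a @ c)" "absorbs_word e (b @ a)" "absorbs_word e (a @ a)"
    "absorbs_word e (a @ b @ c)" "absorbs_word e ((b @ c) @ a)"
    using absorbs_consequence[OF e absorb_right] absorbs_consequence[OF e absorb_left]
      absorbs_consequence[OF e absorb_square] absorbs_consequence[OF e absorb_mult_right]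
      absorbs_consequence[OF e absorb_mult_left] a assms(3,4)
    by (auto simp: absorbs_word_def fold1_times_append mult.assoc)
qed

lemma split2: "2 \<le> length p \<Longrightarrow> \<exists>b c. p = b @ c \<and> b \<noteq> [] \<and> c \<noteq> []"
  by (rule exI[of _ "take 1 p"], rule exI[of _ "drop 1 p"]) auto

text \<open>
  The letter \<open>z\<close> is detached from its neighbours in \<open>q\<close>. The law for \<open>yx\<close>, applied to the summands
  \<open>p\<close> and \<open>zt\<close>, keeps the front factor \<open>z\<close> and replaces \<open>t\<close> by \<open>p\<close>; dually the law for \<open>xz\<close> replaces
  what stands in front. If \<open>z\<close> is an inner letter of \<open>q = szt\<close>, replacing \<open>s\<close> gives \<open>pzt\<close>, and then
  replacing \<open>t\<close> gives \<open>pzp\<close>. Putting \<open>p\<close> on both sides leaves its first and last letters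
  unchanged, so only the set of letters grows.
\<close>
lemma absorbs_word_insert:
  assumes p: "absorbs_word e p" "2 \<le> length p" and q: "absorbs_word e q" "z \<in> set q"
  shows "absorbs_word e (p @ [z] @ p)"
proof -
  obtain s t where st: "q = s @ [z] @ t"
    using q(2) by (auto dest: split_list)
  obtain b c where bc: "p = b @ c" "b \<noteq> []" "c \<noteq> []"
    using split2 p(2) by blast
  have pne: "p \<noteq> []" using p by auto
  show ?thesis
  proof (cases "s = []")
    case True
    have "absorbs_word e ([z] @ p)"
    proof (cases "t = []")
      case True
      then show ?thesis
        using absorbs_word_rules(4)[of e "[z]" b c] \<open>s = []\<close> st q p bc by simp
    next
      case False
      then show ?thesis
        using absorbs_word_rules(2)[of e p "[z]" t] \<open>s = []\<close> st q p by simp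
    qed
    then show ?thesis
      using absorbs_word_rules(4)[of e p "[z]" p] p pne by simp
  next
    case s: False
    show ?thesis
    proof (cases "t = []")
      case True
      have "absorbs_word e (p @ [z])"
        using absorbs_word_rules(1)[of e p s "[z]"] s True st q p by simp
      then show ?thesis
        using absorbs_word_rules(5)[of e p p "[z]"] p pne by simp
    next
      case False
      have "absorbs_word e (p @ [z] @ t)"
        using absorbs_word_rules(1)[of e p s "[z] @ t"] s st q p by simp
      then show ?thesis
        using absorbs_word_rules(2)[of e p "p @ [z]" t] p pne False by simp
    qed
  qed
qed

lemma absorbs_word_enlarge:
  assumes "absorbs_word e p" "2 \<le> length p"
    and "\<And>z. z \<in> set zs \<Longrightarrow> \<exists>q. absorbs_word e q \<and> z \<in> set q"
  shows "\<exists>p'. absorbs_word e p' \<and> 2 \<le> length p' \<and> set p' = set p \<union> set zs"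
  using assms(3)
proof (induction zs)
  case Nil
  then show ?case using assms(1,2) by auto
next
  case (Cons z zs)
  then obtain p' where p': "absorbs_word e p'" "2 \<le> length p'" "set p' = set p \<union> set zs"
    by auto
  obtain q where "absorbs_word e q" "z \<in> set q" using Cons.prems[of z] by auto
  then have "absorbs_word e (p' @ [z] @ p')"
    using p' by (intro absorbs_word_insert)
  then show ?case
    using p' by (intro exI[of _ "p' @ [z] @ p'"]) auto
qed

text \<open>
  The hypotheses are what two-element semirings with addition \<open>max\<close> can say about a product \<open>w\<close> that
  does not change the value of \<open>e\<close> when it is added: there is some product \<open>r\<close> (\<open>T\<^sub>2\<close>),
  a word \<open>p\<close> inside the content of \<open>w\<close> (\<open>D\<^sub>2\<close>), a word through each letter (\<open>M\<^sub>2\<close>), and words with the right first letter (\<open>L\<^sub>2\<close>) and last letter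
  (\<open>R\<^sub>2\<close>). Starting from \<open>pp\<close>, which is a product with the content of \<open>p\<close>, the missing letters are
  inserted one by one and finally the two ends are attached.
\<close>
lemma absorbs_word_product:
  assumes w: "2 \<le> length w"
    and r: "absorbs_word e r" "2 \<le> length r"
    and p: "absorbs_word e p" "set p \<subseteq> set w"
    and content: "\<And>z. z \<in> set w \<Longrightarrow> \<exists>q. absorbs_word e q \<and> z \<in> set q"
    and qh: "absorbs_word e qh" "hd qh = hd w"
    and qt: "absorbs_word e qt" "last qt = last w"
  shows "absorbs_word e w"
proof -
  \<comment> \<open>The law for \<open>x\<^sup>2\<close> needs some product among the absorbed words, which \<open>r\<close> provides.\<close>
  have "\<exists>p'. absorbs_word e p' \<and> 2 \<le> length p' \<and> set p' = set p"
  proof (intro exI[of _ "p @ p"] conjI)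
    obtain b c where "r = b @ c" "b \<noteq> []" "c \<noteq> []"
      using split2 r(2) by blast
    then show "absorbs_word e (p @ p)"
      using absorbs_word_rules(3) p(1) r(1) by blast
    show "2 \<le> length (p @ p)" "set (p @ p) = set p"
      using p(1) by (cases p; simp add: absorbs_word_def)+
  qed
  then obtain p' where p': "absorbs_word e p'" "2 \<le> length p'" "set p' = set p"
    by blast
  obtain s where s: "absorbs_word e s" "2 \<le> length s" "set s = set w"
    using absorbs_word_enlarge[OF p'(1,2), of w, OF content] p'(3) p(2) by (auto simp: Un_absorb1)
  obtain b c where bc: "s = b @ c" "b \<noteq> []" "c \<noteq> []"
    using split2 s(2) by blast
  have sne: "s \<noteq> []" using s by auto
  have h: "absorbs_word e ([hd w] @ s)"
  proof -
    have qne: "qh \<noteq> []" using qh by (simp add: absorbs_word_def)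
    then have eq: "qh = [hd w] @ tl qh" using qh(2) by (cases qh) auto
    show ?thesis
    proof (cases "tl qh = []")
      case True
      then show ?thesis
        using absorbs_word_rules(4)[of e qh b c] qh s bc eq by simp
    next
      case False
      then show ?thesis
        using absorbs_word_rules(2)[of e s "[hd w]" "tl qh"] qh s eq by simp
    qed
  qed
  have ht: "absorbs_word e (([hd w] @ s) @ [last w])"
  proof -
    have qne: "qt \<noteq> []" using qt by (simp add: absorbs_word_def)
    then have eq: "qt = butlast qt @ [last w]" using qt(2) by (metis append_butlast_last_id)
    show ?thesis
    proof (cases "butlast qt = []")
      case True
      then show ?thesis
        using absorbs_word_rules(5)[of e qt "[hd w]" s] qt h sne eq by simp
    next
      case False
      then show ?thesis
        using absorbs_word_rules(1)[of e "[hd w] @ s" "butlast qt" "[last w]"] qt h eq by simp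
    qed
  qed
  have wne: "w \<noteq> []" using w by auto
  have "fold1 (*) (([hd w] @ s) @ [last w]) = fold1 (*) w"
    using w s(3) wne by (intro product_eqI) (auto simp: insert_absorb)
  then show ?thesis
    using ht wne unfolding absorbs_word_def by simp
qed

section \<open>Exchanging absorbed products with the same letters\<close>

text \<open>
  Both sides equal \<open>e + a + 2b\<close>, after \<open>a + b\<close> has been doubled and the surplus pairs have been absorbed.
\<close>
lemma exchange_of_double:
  assumes "absorbs e a" "absorbs e b" "a + b = (a + b) + (a + b)"
  shows "e + a = e + b"
proof -
  have a: "e + (a + a) = e" and b: "e + (b + b) = e"
    using assms(1,2) by (simp_all add: absorbs_def)
  have "e + a = e + (a + b) + b"
    by (subst b[symmetric]) (simp only: ac_simps)
  also have "\<dots> = e + (a + a) + (b + b) + b"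
    by (subst assms(3)) (simp only: ac_simps)
  also have "\<dots> = e + b"
    by (simp only: a b)
  finally show ?thesis .
qed

lemma product_sum_idem:
  assumes "x * y = a + b"
  shows "(a + b) * (a + b) = a + b"
  using product_idem[of x y] assms by simp

text \<open>
  Write the sum of the two words as a product \<open>xy\<close>, with the common first or last letter as one
  factor. Then \<open>(xy)\<^sup>2 = xy\<close> says that the sum is idempotent. By the normal form of words, its
  expanded square contains each of the two words twice, so the sum equals its own double.
\<close>
lemma exchange_same_end:
  assumes a: "absorbs_word e a" "2 \<le> length a" and b: "absorbs_word e b" "2 \<le> length b"
    and "set a = set b" and ends: "hd a = hd b \<or> last a = last b"
  shows "e + fold1 (*) a = e + fold1 (*) b"
proof (rule exchange_of_double)
  let ?a = "fold1 (*) a" and ?b = "fold1 (*) b"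
  show "absorbs e ?a" "absorbs e ?b" using a b by (auto simp: absorbs_word_def)
  have ne: "a \<noteq> []" "b \<noteq> []" using a b by auto
  have sq: "?a * ?a = ?a" "?b * ?b = ?b"
    unfolding fold1_times_append[symmetric, OF ne(1) ne(1)] fold1_times_append[symmetric, OF ne(2) ne(2)]
    by (rule product_eqI; use a b ne in simp)+
  from ends have "\<exists>x y. x * y = ?a + ?b \<and> ?a * ?b + ?b * ?a = ?a + ?b"
  proof
    assume hd: "hd a = hd b"
    have "?a * ?b = ?b" "?b * ?a = ?a"
      unfolding fold1_times_append[symmetric, OF ne] fold1_times_append[symmetric, OF ne(2,1)]
      by (rule product_eqI; use a b ne hd \<open>set a = set b\<close> in simp)+
    moreover have "hd a * (?a + ?b) = ?a + ?b"
      using hd_times_product[OF a(2)] hd_times_product[OF b(2)] hd by (simp add: distrib_left)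
    ultimately show ?thesis
      by (metis add.commute)
  next
    assume last: "last a = last b"
    have "?a * ?b = ?a" "?b * ?a = ?b"
      unfolding fold1_times_append[symmetric, OF ne] fold1_times_append[symmetric, OF ne(2,1)]
      by (rule product_eqI; use a b ne last \<open>set a = set b\<close> in simp)+
    moreover have "(?a + ?b) * last a = ?a + ?b"
      using product_times_last[OF a(2)] product_times_last[OF b(2)] last by (simp add: distrib_right)
    ultimately show ?thesis
      by metis
  qed
  then have prod: "(?a + ?b) * (?a + ?b) = ?a + ?b" and cross: "?a * ?b + ?b * ?a = ?a + ?b"
    using product_sum_idem by auto
  note prod[symmetric]
  also have "(?a + ?b) * (?a + ?b) = (?a * ?a + ?b * ?b) + (?a * ?b + ?b * ?a)"
    by (simp only: distrib_left distrib_right ac_simps)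
  also have "\<dots> = (?a + ?b) + (?a + ?b)"
    by (simp only: sq cross)
  finally show "?a + ?b = (?a + ?b) + (?a + ?b)" .
qed

text \<open>
  The product \<open>ab\<close> has the first letter of \<open>a\<close> and the last letter of \<open>b\<close>, hence is exchangeable with both.
\<close>
lemma exchange_product:
  assumes a: "absorbs_word e a" "2 \<le> length a" and b: "absorbs_word e b" "2 \<le> length b"
    and "set a = set b"
  shows "e + fold1 (*) a = e + fold1 (*) b"
proof -
  obtain c d where cd: "b = c @ d" "c \<noteq> []" "d \<noteq> []"
    using split2 b(2) by blast
  have ne: "a \<noteq> []" "b \<noteq> []" using a b by auto
  have ab: "absorbs_word e (a @ b)"
    using absorbs_word_rules(4)[of e a c d] a b cd by simp
  have "e + fold1 (*) a = e + fold1 (*) (a @ b)"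
    using a ab ne \<open>set a = set b\<close> by (intro exchange_same_end) auto
  also have "\<dots> = e + fold1 (*) b"
    using b ab ne \<open>set a = set b\<close> by (intro exchange_same_end) auto
  finally show ?thesis .
qed

text \<open>
  Words of the same class cancel in pairs: if \<open>g v\<close> is exchangeable with \<open>g w\<close>, then adding both is
  adding \<open>g v\<close> twice.
\<close>
lemma absorbs_even_sum:
  assumes "\<And>w. w \<in> set R \<Longrightarrow> absorbs e (g w)"
    and "\<And>v w. v \<in> set R \<Longrightarrow> w \<in> set R \<Longrightarrow> key v = key w \<Longrightarrow> e + g v = e + g w"
    and "\<And>k. even (length (filter (\<lambda>w. key w = k) R))"
  shows "foldr (+) (map g R) e = e"
  using assms
proof (induction R rule: length_induct)
  case (1 R)
  show ?case
  proof (cases R)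
    case (Cons a R')
    have "odd (length (filter (\<lambda>w. key w = key a) R'))"
      using "1.prems"(3)[of "key a"] Cons by simp
    then have "filter (\<lambda>w. key w = key a) R' \<noteq> []"
      by auto
    then obtain b where "b \<in> set R'" "key b = key a"
      by (auto simp: filter_empty_conv)
    then obtain S T where R': "R' = S @ b # T"
      by (auto dest: split_list)
    have pull: "foldr (+) xs (x + y) = x + foldr (+) xs y" for xs x y
      by (induction xs) (simp_all only: foldr.simps id_apply comp_apply add.left_commute)
    have "even (length (filter (\<lambda>w. key w = k) (S @ T)))" for k
      using "1.prems"(3)[of k] Cons R' \<open>key b = key a\<close> by (simp split: if_splits)
    then have IH: "foldr (+) (map g (S @ T)) e = e"
      using "1.IH" "1.prems" Cons R' by (simp del: map_append filter_append)
    have "e + g a = e + g b"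
      using "1.prems"(2)[of a b] Cons R' \<open>key b = key a\<close> by simp
    then have "g a + (g b + e) = e + (g a + g a)"
      by (metis add.assoc add.commute)
    then have "g a + (g b + e) = e"
      using "1.prems"(1)[of a] Cons by (simp add: absorbs_def)
    have "foldr (+) (map g R) e
        = g a + foldr (+) (map g S) (g b + foldr (+) (map g T) e)"
      by (simp add: Cons R')
    also have "\<dots> = g a + (g b + foldr (+) (map g (S @ T)) e)"
      by (simp only: pull map_append foldr_append)
    also have "\<dots> = g a + (g b + e)"
      by (simp only: IH)
    also have "\<dots> = e" by fact
    finally show ?thesis .
  qed simp
qed

end

section \<open>What the two-element semirings see of a polynomial\<close>

text \<open>
  In this order: \<open>L\<^sub>2\<close>, \<open>R\<^sub>2\<close>, \<open>M\<^sub>2\<close>, \<open>D\<^sub>2\<close>, \<open>N\<^sub>2\<close>, \<open>T\<^sub>2\<close>, \<open>Z\<^sub>2\<close>, \<open>W\<^sub>2\<close>, \<open>Z\<^sub>7\<close>, \<open>Z\<^sub>8\<close>, with \<open>False\<close> for \<open>0\<close> and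
  \<open>True\<close> for \<open>1\<close>.
\<close>
definition two_element_tables :: "((bool \<Rightarrow> bool \<Rightarrow> bool) \<times> (bool \<Rightarrow> bool \<Rightarrow> bool)) list" where
  "two_element_tables =
    [((\<or>), \<lambda>a b. a), ((\<or>), \<lambda>a b. b), ((\<or>), (\<or>)), ((\<or>), (\<and>)),
     ((\<or>), \<lambda>a b. False), ((\<or>), \<lambda>a b. True),
     (\<lambda>a b. False, \<lambda>a b. False), (\<lambda>a b. False, (\<and>)),
     ((\<noteq>), \<lambda>a b. False), ((\<noteq>), (\<and>))]"

definition equal_on_tables :: "'x poly \<Rightarrow> 'x poly \<Rightarrow> bool" where
  "equal_on_tables P Q \<longleftrightarrow> (\<forall>(p, t) \<in> set two_element_tables. \<forall>v.
     poly_value p t v P = poly_value p t v Q)"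

lemma equal_on_tables_sym: "equal_on_tables P Q \<Longrightarrow> equal_on_tables Q P"
  by (auto simp: equal_on_tables_def)

lemma fold1_tables:
  assumes "xs \<noteq> []"
  shows "fold1 (\<or>) xs \<longleftrightarrow> True \<in> set xs"
    and "fold1 (\<and>) xs \<longleftrightarrow> False \<notin> set xs"
    and "fold1 (\<lambda>a b. a) xs \<longleftrightarrow> hd xs"
    and "fold1 (\<lambda>a b. b) xs \<longleftrightarrow> last xs"
    and "fold1 (\<lambda>a b. False) xs \<longleftrightarrow> length xs = 1 \<and> hd xs"
    and "fold1 (\<lambda>a b. True) xs \<longleftrightarrow> 2 \<le> length xs \<or> hd xs"
    and "fold1 (\<noteq>) xs \<longleftrightarrow> odd (length (filter (\<lambda>b. b) xs))"
proof -
  show "fold1 (\<or>) xs \<longleftrightarrow> True \<in> set xs"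
    using assms by (induction xs rule: list_nonempty_induct) (auto simp: fold1_Cons)
  show "fold1 (\<and>) xs \<longleftrightarrow> False \<notin> set xs"
    using assms by (induction xs rule: list_nonempty_induct) (auto simp: fold1_Cons)
  show "fold1 (\<lambda>a b. a) xs \<longleftrightarrow> hd xs"
    using assms by (induction xs rule: list_nonempty_induct) (auto simp: fold1_Cons)
  show "fold1 (\<lambda>a b. b) xs \<longleftrightarrow> last xs"
    using assms by (induction xs rule: list_nonempty_induct) (auto simp: fold1_Cons)
  show "fold1 (\<lambda>a b. False) xs \<longleftrightarrow> length xs = 1 \<and> hd xs"
    using assms by (induction xs rule: list_nonempty_induct) (auto simp: fold1_Cons)
  show "fold1 (\<lambda>a b. True) xs \<longleftrightarrow> 2 \<le> length xs \<or> hd xs"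
    using assms by (induction xs rule: list_nonempty_induct) (auto simp: fold1_Cons Suc_le_eq)
  show "fold1 (\<noteq>) xs \<longleftrightarrow> odd (length (filter (\<lambda>b. b) xs))"
    using assms by (induction xs rule: list_nonempty_induct) (auto simp: fold1_Cons)
qed

text \<open>
  Each table computes one invariant. The last two count the words modulo 2; their values on \<open>P\<close> and
  on \<open>Q\<close> agree iff the combined count over \<open>P @ Q\<close> is even, the form in which pairs can be cancelled.
\<close>
lemma equal_on_tablesD:
  assumes "equal_on_tables P Q" "is_poly P" "is_poly Q"
  shows "(\<exists>w\<in>set P. v (hd w)) \<longleftrightarrow> (\<exists>w\<in>set Q. v (hd w))" (is ?heads)
    and "(\<exists>w\<in>set P. v (last w)) \<longleftrightarrow> (\<exists>w\<in>set Q. v (last w))" (is ?tails)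
    and "(\<exists>w\<in>set P. \<exists>x\<in>set w. v x) \<longleftrightarrow> (\<exists>w\<in>set Q. \<exists>x\<in>set w. v x)" (is ?letters)
    and "(\<exists>w\<in>set P. \<forall>x\<in>set w. v x) \<longleftrightarrow> (\<exists>w\<in>set Q. \<forall>x\<in>set w. v x)" (is ?contents)
    and "(\<exists>w\<in>set P. length w = 1 \<and> v (hd w)) \<longleftrightarrow> (\<exists>w\<in>set Q. length w = 1 \<and> v (hd w))" (is ?linear)
    and "(\<exists>w\<in>set P. 2 \<le> length w \<or> v (hd w)) \<longleftrightarrow> (\<exists>w\<in>set Q. 2 \<le> length w \<or> v (hd w))" (is ?products)
    and "length P = 1 \<and> (\<forall>x\<in>set (hd P). v x) \<longleftrightarrow> length Q = 1 \<and> (\<forall>x\<in>set (hd Q). v x)" (is ?monomial)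
    and "even (length (filter (\<lambda>w. length w = 1 \<and> v (hd w)) (P @ Q)))" (is ?linear_parity)
    and "even (length (filter (\<lambda>w. \<forall>x\<in>set w. v x) (P @ Q)))" (is ?content_parity)
proof -
  have eq: "fold1 p (map (\<lambda>w. fold1 t (map v w)) P) = fold1 p (map (\<lambda>w. fold1 t (map v w)) Q)"
    if "(p, t) \<in> set two_element_tables" for p t
    using assms(1) that by (auto simp: equal_on_tables_def poly_value_def)
  have ne: "P \<noteq> []" "Q \<noteq> []" and words: "w \<in> set P \<Longrightarrow> w \<noteq> []" "w \<in> set Q \<Longrightarrow> w \<noteq> []" for w
    using assms(2,3) by (auto simp: is_poly_def)
  have val: "map (\<lambda>w. fold1 t (map v w)) P = map f P" "map (\<lambda>w. fold1 t (map v w)) Q = map f Q"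
    if "\<And>w. w \<noteq> [] \<Longrightarrow> fold1 t (map v w) = f w" for t f
    using words that by (auto intro!: map_cong)
  have head: "fold1 (\<lambda>a b. a) (map v w) = v (hd w)" if "w \<noteq> []" for w
    using that by (simp add: fold1_tables hd_map)
  have tail: "fold1 (\<lambda>a b. b) (map v w) = v (last w)" if "w \<noteq> []" for w
    using that by (simp add: fold1_tables last_map)
  have letter: "fold1 (\<or>) (map v w) = (\<exists>x\<in>set w. v x)" if "w \<noteq> []" for w
    using that by (auto simp: fold1_tables image_iff)
  have content: "fold1 (\<and>) (map v w) = (\<forall>x\<in>set w. v x)" if "w \<noteq> []" for w
    using that by (auto simp: fold1_tables image_iff)
  have linear: "fold1 (\<lambda>a b. False) (map v w) = (length w = 1 \<and> v (hd w))" if "w \<noteq> []" for w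
    using that by (simp add: fold1_tables hd_map)
  have product: "fold1 (\<lambda>a b. True) (map v w) = (2 \<le> length w \<or> v (hd w))" if "w \<noteq> []" for w
    using that by (simp add: fold1_tables hd_map)
  note tab = two_element_tables_def
  have some: "True \<in> set (map f R) \<longleftrightarrow> (\<exists>w\<in>set R. f w)" for f and R :: "'a poly"
    by auto
  have parity: "length (filter (\<lambda>b. b) (map f R)) = length (filter f R)" for f and R :: "'a poly"
    by (simp add: filter_map comp_def)
  show ?heads using eq[of "(\<or>)" "\<lambda>a b. a"] ne by (simp add: tab val[OF head] fold1_tables some)
  show ?tails using eq[of "(\<or>)" "\<lambda>a b. b"] ne by (simp add: tab val[OF tail] fold1_tables some)
  show ?letters using eq[of "(\<or>)" "(\<or>)"] ne by (simp add: tab val[OF letter] fold1_tables some)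
  show ?contents using eq[of "(\<or>)" "(\<and>)"] ne by (simp add: tab val[OF content] fold1_tables some)
  show ?linear using eq[of "(\<or>)" "\<lambda>a b. False"] ne by (simp add: tab val[OF linear] fold1_tables some)
  show ?products using eq[of "(\<or>)" "\<lambda>a b. True"] ne by (simp add: tab val[OF product] fold1_tables some)
  show ?monomial using eq[of "\<lambda>a b. False" "(\<and>)"] ne
    by (simp add: tab val[OF content] fold1_tables hd_map)
  have even: "even (length (filter f (P @ Q)))"
    if "fold1 (\<noteq>) (map f P) = fold1 (\<noteq>) (map f Q)" for f
  proof -
    have "map f P \<noteq> []" "map f Q \<noteq> []" using ne by auto
    then have "odd (length (filter f P)) = odd (length (filter f Q))"
      using that unfolding parity[symmetric] by (metis fold1_tables(7))
    then show ?thesis by auto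
  qed
  have "((\<noteq>), \<lambda>a b. False) \<in> set two_element_tables"
    by (simp add: tab)
  from eq[OF this] show ?linear_parity
    by (intro even) (simp add: val[OF linear])
  have "((\<noteq>), (\<and>)) \<in> set two_element_tables"
    by (simp add: tab)
  from eq[OF this] show ?content_parity
    by (intro even) (simp add: val[OF content])
qed

text \<open>
  Counting the words with content below \<open>C\<close> is counting by exact content and summing over the subsets
  of \<open>C\<close>; by induction all the proper subsets contribute even numbers.
\<close>
lemma even_exact_content:
  assumes "\<And>v. even (length (filter (\<lambda>w. \<forall>x\<in>set w. v x) R))"
  shows "even (length (filter (\<lambda>w. set w = C) R))"
proof (cases "finite C")
  case True
  then show ?thesis
  proof (induction C rule: finite_psubset_induct)
    case (psubset C)
    let ?n = "\<lambda>D. length (filter (\<lambda>w. set w = D) R)"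
    have "length (filter (\<lambda>w. set w \<subseteq> C) ws) = (\<Sum>D\<in>Pow C. length (filter (\<lambda>w. set w = D) ws))"
      for ws :: "'a list list"
    proof (induction ws)
      case (Cons w ws)
      have "length (filter (\<lambda>w. set w \<subseteq> C) (w # ws))
          = (if set w \<subseteq> C then 1 else 0) + (\<Sum>D\<in>Pow C. length (filter (\<lambda>w. set w = D) ws))"
        using Cons by simp
      also have "\<dots> = (\<Sum>D\<in>Pow C. (if set w = D then 1 else 0) + length (filter (\<lambda>w. set w = D) ws))"
        using psubset.hyps by (simp add: sum.distrib)
      also have "\<dots> = (\<Sum>D\<in>Pow C. length (filter (\<lambda>w. set w = D) (w # ws)))"
        by (intro sum.cong) auto
      finally show ?case .
    qed simp
    then have "length (filter (\<lambda>w. set w \<subseteq> C) R) = ?n C + (\<Sum>D\<in>Pow C - {C}. ?n D)"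
      using psubset.hyps by (simp add: sum.remove[of "Pow C" C])
    moreover have "even (length (filter (\<lambda>w. set w \<subseteq> C) R))"
      using assms[of "\<lambda>x. x \<in> C"] by (simp add: subset_eq)
    moreover have "even (\<Sum>D\<in>Pow C - {C}. ?n D)"
      using psubset.IH by (intro dvd_sum) auto
    ultimately show ?case by simp
  qed
next
  case False
  then have "filter (\<lambda>w. set w = C) R = []"
    by (auto simp: filter_empty_conv)
  then show ?thesis by simp
qed

text \<open>
  The class of a word records its set of letters and whether it is a single letter: \<open>x\<close> and \<open>xx\<close> have
  the same content but need not have the same value. \<open>Z\<^sub>7\<close> counts the single letters, \<open>Z\<^sub>8\<close> both kinds
  together.
\<close>
lemma even_class:
  assumes "[] \<notin> set R"
    and lin: "\<And>v. even (length (filter (\<lambda>w. length w = 1 \<and> v (hd w)) R))"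
    and cont: "\<And>v. even (length (filter (\<lambda>w. \<forall>x\<in>set w. v x) R))"
  shows "even (length (filter (\<lambda>w. (length w = 1, set w) = k) R))"
proof -
  obtain b C where k: "k = (b, C)" by (cases k)
  have one: "even (length (filter (\<lambda>w. length w = 1 \<and> set w = C) R))"
  proof -
    have "(length w = 1 \<and> set w = C) = (length w = 1 \<and> C = {hd w})" for w
      by (cases w) auto
    then show ?thesis using lin[of "\<lambda>x. C = {x}"] by simp
  qed
  have split: "length (filter (\<lambda>w. set w = C) S)
      = length (filter (\<lambda>w. length w = 1 \<and> set w = C) S)
      + length (filter (\<lambda>w. length w \<noteq> 1 \<and> set w = C) S)" for S :: "'a list list"
    by (induction S) auto
  have "even (length (filter (\<lambda>w. length w \<noteq> 1 \<and> set w = C) R))"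
    using split[of R] one even_exact_content[OF cont, of C] by simp
  then show ?thesis
    using one unfolding k by (cases b) simp_all
qed

section \<open>Completeness of the ten identities\<close>

lemma two_le_length: "w \<noteq> [] \<Longrightarrow> length w \<noteq> 1 \<Longrightarrow> 2 \<le> length w"
  by (cases w; cases "tl w") auto

lemma single_letter: "w \<noteq> [] \<Longrightarrow> \<not> 2 \<le> length w \<Longrightarrow> w = [hd w]"
  by (cases w; cases "tl w") auto

context sr2
begin

lemma absorbs_fold1:
  assumes "xs \<noteq> []" "\<And>a. a \<in> set xs \<Longrightarrow> absorbs e a"
  shows "absorbs e (fold1 (+) xs)"
  using fold1_closed[of "{a. absorbs e a}" "(+)" xs] assms absorbs_add by auto

lemma fold1_absorbs_summand:
  assumes "a \<in> set xs" "2 \<le> length xs"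
  shows "absorbs (fold1 (+) xs) a"
proof -
  obtain S T where xs: "xs = S @ a # T"
    using assms(1) by (auto dest: split_list)
  have "absorbs (fold1 (+) (a # T)) a" if "T \<noteq> []"
    using that absorbs_summand[of "fold1 (+) T" a] by (simp add: fold1_Cons add.commute)
  moreover have "fold1 (+) (S @ a # T) = fold1 (+) S + fold1 (+) (a # T)" if "S \<noteq> []"
    using that by (intro fold1_append) (auto simp: add.assoc)
  ultimately show ?thesis
    using assms(2) absorbs_summand absorbs_add_left unfolding xs
    by (cases "S = []"; cases "T = []") auto
qed

text \<open>
  For a product \<open>w\<close> the tables with addition \<open>max\<close> provide the words of \<open>P\<close> from which \<open>w\<close> is built;
  for a single letter, \<open>N\<^sub>2\<close> shows that it is a word of \<open>P\<close> itself.
\<close>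
lemma word_absorbed_by_equal_poly:
  assumes eq: "equal_on_tables P Q" and P: "is_poly P" "2 \<le> length P" and Q: "is_poly Q"
    and w: "w \<in> set Q"
  shows "absorbs (poly_value (+) (*) id P) (fold1 (*) w)"
proof -
  let ?e = "poly_value (+) (*) id P"
  note inv = equal_on_tablesD[OF eq P(1) Q]
  have P_abs: "absorbs_word ?e q" if "q \<in> set P" for q
  proof -
    have "absorbs ?e (fold1 (*) q)"
      unfolding poly_value_def using that P(2) by (intro fold1_absorbs_summand) auto
    then show ?thesis using that P(1) by (auto simp: absorbs_word_def is_poly_def)
  qed
  have wne: "w \<noteq> []" using w Q by (auto simp: is_poly_def)
  have "absorbs_word ?e w"
  proof (cases "length w = 1")
    case True
    then obtain q where "q \<in> set P" "length q = 1" "hd q = hd w"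
      using inv(5)[of "\<lambda>x. x = hd w"] w by auto
    then have "q = w" using True by (auto simp: length_Suc_conv)
    then show ?thesis using P_abs \<open>q \<in> set P\<close> by simp
  next
    case False
    then have len: "2 \<le> length w"
      using wne by (intro two_le_length)
    obtain r where r: "r \<in> set P" "2 \<le> length r"
      using inv(6)[of "\<lambda>x. False"] w len by auto
    obtain p where p: "p \<in> set P" "set p \<subseteq> set w"
      using inv(4)[of "\<lambda>x. x \<in> set w"] w by blast
    obtain h where h: "h \<in> set P" "hd h = hd w"
      using inv(1)[of "\<lambda>x. x = hd w"] w by auto
    obtain t where t: "t \<in> set P" "last t = last w"
      using inv(2)[of "\<lambda>x. x = last w"] w by auto
    have "\<exists>q. absorbs_word ?e q \<and> z \<in> set q" if "z \<in> set w" for z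
      using inv(3)[of "\<lambda>x. x = z"] w that P_abs by auto
    then show ?thesis
      using len P_abs r p h t by (intro absorbs_word_product[of w ?e r p h t]) auto
  qed
  then show ?thesis by (simp add: absorbs_word_def)
qed

lemma equal_single_words:
  assumes "equal_on_tables [a] [b]" "a \<noteq> []" "b \<noteq> []"
  shows "fold1 (*) a = fold1 (*) b"
proof -
  have "is_poly [a]" "is_poly [b]" using assms by (auto simp: is_poly_def)
  note inv = equal_on_tablesD[OF assms(1) this]
  have hd: "hd a = hd b" using inv(1)[of "\<lambda>x. x = hd a"] by simp
  have last: "last a = last b" using inv(2)[of "\<lambda>x. x = last a"] by simp
  have set: "set a = set b"
    using inv(4)[of "\<lambda>x. x \<in> set a"] inv(4)[of "\<lambda>x. x \<in> set b"] by auto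
  have len: "2 \<le> length a \<longleftrightarrow> 2 \<le> length b"
    using inv(6)[of "\<lambda>x. False"] by simp
  show ?thesis
  proof (cases "2 \<le> length a")
    case True
    then show ?thesis using hd last set len by (intro product_eqI) auto
  next
    case False
    then have "a = b" using single_letter[of a] single_letter[of b] len hd assms(2,3)
      by metis
    then show ?thesis by simp
  qed
qed

text \<open>
  \<open>W\<^sub>2\<close> separates single words from longer sums. For longer sums with values \<open>u\<close> and \<open>v\<close>, each absorbs the
  words of both polynomials, and so does \<open>e = 2u + 2v\<close>; moreover \<open>u + e = u\<close> and \<open>v + e = v\<close>. Since every
  class of words occurs an even number of times in \<open>P @ Q\<close>, the sum \<open>u + v\<close> vanishes next to \<open>e\<close>,
  and \<open>u = u + (u + v + e) = v + e = v\<close>.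
\<close>
theorem equal_on_tables_imp_eq:
  assumes eq: "equal_on_tables P Q" and P: "is_poly P" and Q: "is_poly Q"
  shows "poly_value (+) (*) id P = poly_value (+) (*) id Q"
proof -
  note inv = equal_on_tablesD[OF eq P Q]
  have ne: "P \<noteq> []" "Q \<noteq> []" using P Q by (auto simp: is_poly_def)
  have len: "length P = 1 \<longleftrightarrow> length Q = 1"
    using inv(7)[of "\<lambda>x. True"] by simp
  show ?thesis
  proof (cases "length P = 1")
    case True
    then obtain a b where "P = [a]" "Q = [b]"
      using len by (metis One_nat_def length_0_conv length_Suc_conv)
    then show ?thesis
      using equal_single_words[of a b] eq P Q by (auto simp: poly_value_def is_poly_def)
  next
    case False
    then have two: "2 \<le> length P" "2 \<le> length Q"
      using len False ne by (auto intro!: two_le_length)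
    let ?u = "poly_value (+) (*) id P" and ?v = "poly_value (+) (*) id Q"
    have refl: "equal_on_tables P P" "equal_on_tables Q Q" by (auto simp: equal_on_tables_def)
    have u: "absorbs ?u (fold1 (*) w)" and v: "absorbs ?v (fold1 (*) w)" if "w \<in> set (P @ Q)" for w
      using that word_absorbed_by_equal_poly[OF eq P two(1) Q] word_absorbed_by_equal_poly[OF refl(1) P two(1) P]
        word_absorbed_by_equal_poly[OF equal_on_tables_sym[OF eq] Q two(2) P]
        word_absorbed_by_equal_poly[OF refl(2) Q two(2) Q] by auto
    have uu: "absorbs ?u ?u" "absorbs ?u ?v" and vv: "absorbs ?v ?v" "absorbs ?v ?u"
      unfolding poly_value_def using u v ne by (auto intro!: absorbs_fold1 simp: poly_value_def)
    define e where "e = (?u + ?u) + (?v + ?v)"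
    have e: "absorbs e (fold1 (*) w)" if "w \<in> set (P @ Q)" for w
      using u[OF that] by (simp add: e_def absorbs_add_left absorbs_add_right)
    have "foldr (+) (map (fold1 (*)) (P @ Q)) e = e"
    proof (rule absorbs_even_sum[where key = "\<lambda>w. (length w = 1, set w)"])
      fix a b assume a: "a \<in> set (P @ Q)" and b: "b \<in> set (P @ Q)"
        and key: "(length a = 1, set a) = (length b = 1, set b)"
      have nil: "a \<noteq> []" "b \<noteq> []" using a b P Q by (auto simp: is_poly_def)
      then have words: "absorbs_word e a" "absorbs_word e b"
        using e[OF a] e[OF b] by (simp_all add: absorbs_word_def)
      show "e + fold1 (*) a = e + fold1 (*) b"
      proof (cases "length a = 1")
        case True
        then have "a = b" using key by (cases a; cases b) auto
        then show ?thesis by simp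
      next
        case False
        then have "2 \<le> length a" "2 \<le> length b"
          using key nil False by (auto intro!: two_le_length)
        then show ?thesis
          using words key by (intro exchange_product) auto
      qed
    next
      fix k
      show "even (length (filter (\<lambda>w. (length w = 1, set w) = k) (P @ Q)))"
        using P Q inv(8,9) by (intro even_class) (auto simp: is_poly_def)
    qed (use e in auto)
    moreover have "foldr (+) xs y = fold1 (+) xs + y" if "xs \<noteq> []" for xs y
      using that by (induction xs rule: list_nonempty_induct) (auto simp: fold1_Cons add.assoc)
    ultimately have "?u + (?v + e) = e"
      using ne by (simp add: poly_value_def)
    moreover have "?u + e = ?u" "?v + e = ?v"
      using uu vv by (simp_all add: e_def absorbs_def add.assoc[symmetric])
    ultimately show ?thesis
      using vv(2) by (metis absorbs_def add.assoc add.commute)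
  qed
qed

end

section \<open>Identities and varieties\<close>
datatype (vars: 'v) trm = Var 'v | Add "'v trm" "'v trm" | Mul "'v trm" "'v trm"

primrec eval :: "'a alg \<Rightarrow> ('v \<Rightarrow> 'a) \<Rightarrow> 'v trm \<Rightarrow> 'a" where
  "eval A v (Var n) = v n"
| "eval A v (Add s t) = eval A v s \<oplus>\<^bsub>A\<^esub> eval A v t"
| "eval A v (Mul s t) = eval A v s \<otimes>\<^bsub>A\<^esub> eval A v t"

text \<open>
  Every semiring is nonempty and closed, so these two properties are part of being a model; the
  carrier being a subuniverse of the algebra itself expresses both.
\<close>
definition models :: "('v trm \<times> 'v trm) set \<Rightarrow> 'a alg \<Rightarrow> bool" where
  "models E A \<longleftrightarrow> subuniverse (carrier A) A \<and>
     (\<forall>(s, t)\<in>E. \<forall>v. range v \<subseteq> carrier A \<longrightarrow> eval A v s = eval A v t)"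

lemma eval_in_subuniverse:
  "subuniverse H A \<Longrightarrow> range v \<subseteq> H \<Longrightarrow> eval A v s \<in> H"
  by (induction s) (auto simp: subuniverse_def)

lemma eval_hom:
  assumes "f \<in> alg_hom A B" "subuniverse (carrier A) A" "range v \<subseteq> carrier A"
  shows "f (eval A v s) = eval B (f \<circ> v) s"
  using assms(1) eval_in_subuniverse[OF assms(2,3)] by (induction s) (auto simp: alg_hom_def)

lemma models_hom_image:
  assumes A: "models E A" and "hom_image A B"
  shows "models E B"
proof -
  obtain f where f: "f \<in> alg_hom A B" "f ` carrier A = carrier B"
    using assms(2) by (auto simp: hom_image_def)
  have sub: "subuniverse (carrier A) A" using A by (simp add: models_def)
  have "subuniverse (carrier B) B"
    unfolding subuniverse_def f(2)[symmetric]
  proof (intro conjI ballI)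
    fix x y assume "x \<in> f ` carrier A" "y \<in> f ` carrier A"
    then obtain a b where ab: "a \<in> carrier A" "b \<in> carrier A" "x = f a" "y = f b" by auto
    then have "x \<oplus>\<^bsub>B\<^esub> y = f (a \<oplus>\<^bsub>A\<^esub> b)" "x \<otimes>\<^bsub>B\<^esub> y = f (a \<otimes>\<^bsub>A\<^esub> b)"
      using f(1) by (simp_all add: alg_hom_def)
    then show "x \<oplus>\<^bsub>B\<^esub> y \<in> f ` carrier A" "x \<otimes>\<^bsub>B\<^esub> y \<in> f ` carrier A"
      using sub ab by (auto simp: subuniverse_def)
  qed (use sub in \<open>auto simp: subuniverse_def\<close>)
  moreover have "eval B v s = eval B v t" if "(s, t) \<in> E" "range v \<subseteq> carrier B" for s t v
  proof -
    have "\<forall>n. \<exists>a\<in>carrier A. f a = v n" using that(2) f(2) by (metis imageE range_subsetD)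
    then obtain u where u: "\<And>n. u n \<in> carrier A" "\<And>n. f (u n) = v n" by metis
    then have v: "v = f \<circ> u" and ur: "range u \<subseteq> carrier A" by auto
    have "eval A u s = eval A u t" using A that(1) ur by (auto simp: models_def)
    then show ?thesis unfolding v by (simp add: eval_hom[OF f(1) sub ur, symmetric])
  qed
  ultimately show ?thesis by (auto simp: models_def)
qed

lemma hom_image_of_alg_iso: "alg_iso A B \<Longrightarrow> hom_image A B"
  by (auto simp: alg_iso_def hom_image_def bij_betw_def)

lemma models_subuniverse:
  fixes E :: "('v trm \<times> 'v trm) set"
  assumes "models E A" "subuniverse H A"
  shows "models E (A\<lparr>carrier := H\<rparr>)"
proof -
  have "eval (A\<lparr>carrier := H\<rparr>) v s = eval A v s" for v :: "'v \<Rightarrow> 'a" and s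
    by (induction s) auto
  moreover have "subuniverse H (A\<lparr>carrier := H\<rparr>)"
    using assms(2) by (simp add: subuniverse_def)
  moreover have "eval A v s = eval A v t" if "(s, t) \<in> E" "range v \<subseteq> H" for s t v
  proof -
    have "range v \<subseteq> carrier A"
      using that(2) assms(2) unfolding subuniverse_def by blast
    then show ?thesis
      using assms(1) that(1) unfolding models_def by blast
  qed
  ultimately show ?thesis
    by (auto simp: models_def)
qed

lemma models_direct_product:
  assumes "\<And>i. i \<in> I \<Longrightarrow> models E (F i)"
  shows "models E (direct_product I F)"
proof -
  let ?P = "direct_product I F"
  have sub: "subuniverse (carrier (F i)) (F i)" if "i \<in> I" for i
    using assms that by (simp add: models_def)
  have "(\<Pi>\<^sub>E i\<in>I. carrier (F i)) \<noteq> {}"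
    using sub by (auto simp: PiE_eq_empty_iff subuniverse_def)
  then have "subuniverse (carrier ?P) ?P"
    using sub unfolding subuniverse_def direct_product_def by fastforce
  moreover have "eval ?P v s = eval ?P v t" if st: "(s, t) \<in> E" and v: "range v \<subseteq> carrier ?P" for s t v
  proof -
    have vn: "v n \<in> (\<Pi>\<^sub>E i\<in>I. carrier (F i))" for n
      using v by (auto simp: direct_product_def)
    have *: "eval ?P v r = (\<lambda>i\<in>I. eval (F i) (\<lambda>n. v n i) r)" for r
      using vn by (induction r) (auto simp: direct_product_def fun_eq_iff PiE_def extensional_def)
    have "eval (F i) (\<lambda>n. v n i) s = eval (F i) (\<lambda>n. v n i) t" if "i \<in> I" for i
    proof -
      have "range (\<lambda>n. v n i) \<subseteq> carrier (F i)" using vn that by auto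
      then show ?thesis using assms[OF that] st by (auto simp: models_def)
    qed
    then show ?thesis unfolding * by (auto simp: restrict_def)
  qed
  ultimately show ?thesis by (auto simp: models_def)
qed

abbreviation (input) "vx \<equiv> Var 0"
abbreviation (input) "vy \<equiv> Var 1"
abbreviation (input) "vz \<equiv> Var 2"
abbreviation (input) "vt \<equiv> Var 3"

definition semiring_ids :: "(nat trm \<times> nat trm) set" where
  "semiring_ids =
    {(Add vx vy, Add vy vx),
     (Add (Add vx vy) vz, Add vx (Add vy vz)),
     (Mul (Mul vx vy) vz, Mul vx (Mul vy vz)),
     (Mul vx (Add vy vz), Add (Mul vx vy) (Mul vx vz)),
     (Mul (Add vy vz) vx, Add (Mul vy vx) (Mul vz vx))}"

definition sr2_ids :: "(nat trm \<times> nat trm) set" where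
  "sr2_ids =
    (let twice = (\<lambda>w. Add w w) in
    {(Mul (Mul vx vx) vy, Mul vx vy),
     (Mul (Mul vx vy) vy, Mul vx vy),
     (Mul (Mul (Mul vx vy) vz) vt, Mul (Mul (Mul vx vz) vy) vt),
     (Mul (Mul vx vy) (Mul vx vy), Mul vx vy),
     (Add vx (Mul vy vz), Add (Add vx (Mul vy vz)) (twice (Mul vx vz))),
     (Add vx (Mul vy vz), Add (Add vx (Mul vy vz)) (twice (Mul vy vx))),
     (Add vx (Mul vy vz), Add (Add vx (Mul vy vz)) (twice (Mul vx vx))),
     (Add vx (Mul vy vz), Add (Add vx (Mul vy vz)) (twice (Mul (Mul vx vy) vz))),
     (Add vx (Mul vy vz), Add (Add vx (Mul vy vz)) (twice (Mul (Mul vy vz) vx))),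
     (Add vx vy, Add vx (Add (Add vy vy) vy))})"

lemma eval_cong: "(\<And>n. n \<in> vars s \<Longrightarrow> u n = v n) \<Longrightarrow> eval A u s = eval A v s"
  by (induction s) auto

text \<open>
  Valuations of infinitely many variables are traded for quantifiers over four elements, so that
  the models of identities in four variables can be compared with laws in their usual form.
\<close>
lemma models_four_variables:
  assumes "\<And>s t. (s, t) \<in> E \<Longrightarrow> vars s \<union> vars t \<subseteq> {0, 1, 2, 3 :: nat}"
  shows "models E A \<longleftrightarrow> subuniverse (carrier A) A \<and>
    (\<forall>(s, t)\<in>E. \<forall>x\<in>carrier A. \<forall>y\<in>carrier A. \<forall>z\<in>carrier A. \<forall>w\<in>carrier A.
       eval A ((!) [x, y, z, w]) s = eval A ((!) [x, y, z, w]) t)"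
proof -
  have "(\<forall>v. range v \<subseteq> carrier A \<longrightarrow> eval A v s = eval A v t) \<longleftrightarrow>
    (\<forall>x\<in>carrier A. \<forall>y\<in>carrier A. \<forall>z\<in>carrier A. \<forall>w\<in>carrier A.
       eval A ((!) [x, y, z, w]) s = eval A ((!) [x, y, z, w]) t)" (is "?L \<longleftrightarrow> ?R")
    if "(s, t) \<in> E" for s t
  proof
    assume L: ?L
    show ?R
    proof (intro ballI)
      fix x y z w assume C: "x \<in> carrier A" "y \<in> carrier A" "z \<in> carrier A" "w \<in> carrier A"
      define v where "v = (\<lambda>n. if n < 4 then [x, y, z, w] ! n else x)"
      have "v n \<in> carrier A" for n
        using C by (auto simp: v_def less_Suc_eq numeral_eq_Suc)
      then have "eval A v s = eval A v t"
        using L by auto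
      moreover have "eval A ((!) [x, y, z, w]) r = eval A v r" if "vars r \<subseteq> {0, 1, 2, 3}" for r
        using that by (intro eval_cong) (auto simp: v_def)
      ultimately show "eval A ((!) [x, y, z, w]) s = eval A ((!) [x, y, z, w]) t"
        using assms \<open>(s, t) \<in> E\<close> by simp
    qed
  next
    assume R: ?R
    show ?L
    proof (intro allI impI)
      fix v :: "nat \<Rightarrow> 'a" assume "range v \<subseteq> carrier A"
      then have "v n \<in> carrier A" for n by auto
      then have "eval A ((!) [v 0, v 1, v 2, v 3]) s = eval A ((!) [v 0, v 1, v 2, v 3]) t"
        using R by blast
      moreover have "eval A ((!) [v 0, v 1, v 2, v 3]) r = eval A v r" if "vars r \<subseteq> {0, 1, 2, 3}" for r
        using that by (intro eval_cong) auto
      ultimately show "eval A v s = eval A v t"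
        using assms \<open>(s, t) \<in> E\<close> by simp
    qed
  qed
  then show ?thesis unfolding models_def by blast
qed

lemma is_semiring_iff_models: "is_semiring A \<longleftrightarrow> models semiring_ids A"
proof (cases "carrier A = {}")
  case False
  have "models semiring_ids A \<longleftrightarrow> subuniverse (carrier A) A \<and>
    (\<forall>(s, t)\<in>semiring_ids. \<forall>x\<in>carrier A. \<forall>y\<in>carrier A. \<forall>z\<in>carrier A. \<forall>w\<in>carrier A.
       eval A ((!) [x, y, z, w]) s = eval A ((!) [x, y, z, w]) t)"
    by (rule models_four_variables) (auto simp: semiring_ids_def)
  also have "\<dots> \<longleftrightarrow> is_semiring A"
    using False by (simp add: semiring_ids_def is_semiring_def subuniverse_def) blast
  finally show ?thesis by simp
qed (simp add: is_semiring_def models_def subuniverse_def)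

lemma variety_models:
  assumes "semiring_ids \<subseteq> E"
  shows "variety {A. models E A}"
  unfolding variety_def
proof (intro conjI ballI allI impI)
  fix A :: "'a alg" assume "A \<in> {A. models E A}"
  then show "is_semiring A"
    using assms unfolding is_semiring_iff_models models_def by blast
next
  fix A B :: "'a alg" assume "A \<in> {A. models E A}" "hom_image A B"
  then show "B \<in> {A. models E A}"
    using models_hom_image by simp
next
  fix A :: "'a alg" and H assume "A \<in> {A. models E A}" "subuniverse H A"
  then show "A\<lparr>carrier := H\<rparr> \<in> {A. models E A}"
    using models_subuniverse by simp
next
  fix I :: "'a set" and F and B :: "'a alg"
  assume "(\<forall>i\<in>I. F i \<in> {A. models E A}) \<and> alg_iso (direct_product I F) B"
  then show "B \<in> {A. models E A}"
    by (auto intro: models_hom_image[OF models_direct_product hom_image_of_alg_iso])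
qed

definition sr2_laws :: "'a alg \<Rightarrow> bool" where
  "sr2_laws S \<longleftrightarrow>
       (\<forall>x\<in>carrier S. \<forall>y\<in>carrier S. x \<otimes>\<^bsub>S\<^esub> x \<otimes>\<^bsub>S\<^esub> y = x \<otimes>\<^bsub>S\<^esub> y) \<and>
       (\<forall>x\<in>carrier S. \<forall>y\<in>carrier S. x \<otimes>\<^bsub>S\<^esub> y \<otimes>\<^bsub>S\<^esub> y = x \<otimes>\<^bsub>S\<^esub> y) \<and>
       (\<forall>x\<in>carrier S. \<forall>y\<in>carrier S. \<forall>z\<in>carrier S. \<forall>t\<in>carrier S.
          x \<otimes>\<^bsub>S\<^esub> y \<otimes>\<^bsub>S\<^esub> z \<otimes>\<^bsub>S\<^esub> t = x \<otimes>\<^bsub>S\<^esub> z \<otimes>\<^bsub>S\<^esub> y \<otimes>\<^bsub>S\<^esub> t) \<and>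
       (\<forall>x\<in>carrier S. \<forall>y\<in>carrier S. (x \<otimes>\<^bsub>S\<^esub> y) \<otimes>\<^bsub>S\<^esub> (x \<otimes>\<^bsub>S\<^esub> y) = x \<otimes>\<^bsub>S\<^esub> y) \<and>
       (\<forall>x\<in>carrier S. \<forall>y\<in>carrier S. \<forall>z\<in>carrier S.
          x \<oplus>\<^bsub>S\<^esub> y \<otimes>\<^bsub>S\<^esub> z = x \<oplus>\<^bsub>S\<^esub> y \<otimes>\<^bsub>S\<^esub> z \<oplus>\<^bsub>S\<^esub> (x \<otimes>\<^bsub>S\<^esub> z \<oplus>\<^bsub>S\<^esub> x \<otimes>\<^bsub>S\<^esub> z)) \<and>
       (\<forall>x\<in>carrier S. \<forall>y\<in>carrier S. \<forall>z\<in>carrier S.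
          x \<oplus>\<^bsub>S\<^esub> y \<otimes>\<^bsub>S\<^esub> z = x \<oplus>\<^bsub>S\<^esub> y \<otimes>\<^bsub>S\<^esub> z \<oplus>\<^bsub>S\<^esub> (y \<otimes>\<^bsub>S\<^esub> x \<oplus>\<^bsub>S\<^esub> y \<otimes>\<^bsub>S\<^esub> x)) \<and>
       (\<forall>x\<in>carrier S. \<forall>y\<in>carrier S. \<forall>z\<in>carrier S.
          x \<oplus>\<^bsub>S\<^esub> y \<otimes>\<^bsub>S\<^esub> z = x \<oplus>\<^bsub>S\<^esub> y \<otimes>\<^bsub>S\<^esub> z \<oplus>\<^bsub>S\<^esub> (x \<otimes>\<^bsub>S\<^esub> x \<oplus>\<^bsub>S\<^esub> x \<otimes>\<^bsub>S\<^esub> x)) \<and>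
       (\<forall>x\<in>carrier S. \<forall>y\<in>carrier S. \<forall>z\<in>carrier S.
          x \<oplus>\<^bsub>S\<^esub> y \<otimes>\<^bsub>S\<^esub> z = x \<oplus>\<^bsub>S\<^esub> y \<otimes>\<^bsub>S\<^esub> z \<oplus>\<^bsub>S\<^esub> (x \<otimes>\<^bsub>S\<^esub> y \<otimes>\<^bsub>S\<^esub> z \<oplus>\<^bsub>S\<^esub> x \<otimes>\<^bsub>S\<^esub> y \<otimes>\<^bsub>S\<^esub> z)) \<and>
       (\<forall>x\<in>carrier S. \<forall>y\<in>carrier S. \<forall>z\<in>carrier S.
          x \<oplus>\<^bsub>S\<^esub> y \<otimes>\<^bsub>S\<^esub> z = x \<oplus>\<^bsub>S\<^esub> y \<otimes>\<^bsub>S\<^esub> z \<oplus>\<^bsub>S\<^esub> (y \<otimes>\<^bsub>S\<^esub> z \<otimes>\<^bsub>S\<^esub> x \<oplus>\<^bsub>S\<^esub> y \<otimes>\<^bsub>S\<^esub> z \<otimes>\<^bsub>S\<^esub> x)) \<and>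
       (\<forall>x\<in>carrier S. \<forall>y\<in>carrier S. x \<oplus>\<^bsub>S\<^esub> y = x \<oplus>\<^bsub>S\<^esub> (y \<oplus>\<^bsub>S\<^esub> y \<oplus>\<^bsub>S\<^esub> y))"

lemma models_sr2_iff: "models (semiring_ids \<union> sr2_ids) S \<longleftrightarrow> is_semiring S \<and> sr2_laws S"
proof (cases "carrier S = {}")
  case False
  have split: "models (semiring_ids \<union> sr2_ids) S \<longleftrightarrow> is_semiring S \<and> models sr2_ids S"
    unfolding is_semiring_iff_models models_def by blast
  have "models sr2_ids S \<longleftrightarrow> subuniverse (carrier S) S \<and>
    (\<forall>(s, t)\<in>sr2_ids. \<forall>x\<in>carrier S. \<forall>y\<in>carrier S. \<forall>z\<in>carrier S. \<forall>w\<in>carrier S.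
       eval S ((!) [x, y, z, w]) s = eval S ((!) [x, y, z, w]) t)"
    by (rule models_four_variables) (auto simp: sr2_ids_def Let_def)
  also have "\<dots> \<longleftrightarrow> subuniverse (carrier S) S \<and> sr2_laws S"
    using False by (simp add: sr2_ids_def Let_def sr2_laws_def ex_in_conv)
  finally have "models sr2_ids S \<longleftrightarrow> subuniverse (carrier S) S \<and> sr2_laws S" .
  moreover have "is_semiring S \<Longrightarrow> subuniverse (carrier S) S"
    by (simp add: is_semiring_iff_models models_def)
  ultimately show ?thesis using split by blast
qed (simp add: is_semiring_def models_def subuniverse_def)

section \<open>The ten identities in semirings of order two\<close>
lemma bool_semiring_laws:
  assumes B: "is_semiring B" and "carrier B = (UNIV :: bool set)"
  shows "sr2_laws B"
proof -
  define p where "p = plus B"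
  define t where "t = times B"
  have comm: "p x y = p y x" for x y
    using assms unfolding is_semiring_def p_def by blast
  have laws: "\<forall>x y z. p (p x y) z = p x (p y z) \<and> t (t x y) z = t x (t y z) \<and>
      t x (p y z) = p (t x y) (t x z) \<and> t (p y z) x = p (t y x) (t z x)"
    using assms unfolding is_semiring_def p_def t_def by blast
  show ?thesis
    unfolding sr2_laws_def assms(2) p_def[symmetric] t_def[symmetric]
    \<comment> \<open>commutativity fixes the eighth entry of the two operation tables\<close>
    using laws comm[of False True]
    by (cases "p True True"; cases "p False False"; cases "p True False";
        cases "t True True"; cases "t False False"; cases "t True False"; cases "t False True";
        simp add: all_bool_eq)
qed

lemma two_element_laws:
  assumes S: "is_semiring S" and "card (carrier S) = 2"
  shows "sr2_laws S"
proof -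
  obtain a b where C: "carrier S = {a, b}" and ab: "a \<noteq> b"
    using assms(2) by (auto simp: card_2_iff)
  define f where "f c = (if c then b else a)" for c
  define g where "g x = (x = b)" for x
  have gf [simp]: "g (f c) = c" for c using ab by (simp add: f_def g_def)
  have fg [simp]: "x \<in> carrier S \<Longrightarrow> f (g x) = x" for x using C by (auto simp: f_def g_def)
  have f [simp]: "f c \<in> carrier S" for c using C by (simp add: f_def)
  define B where "B = \<lparr>carrier = UNIV, plus = (\<lambda>c d. g (f c \<oplus>\<^bsub>S\<^esub> f d)), times = (\<lambda>c d. g (f c \<otimes>\<^bsub>S\<^esub> f d))\<rparr>"
  have closed: "x \<oplus>\<^bsub>S\<^esub> y \<in> carrier S" "x \<otimes>\<^bsub>S\<^esub> y \<in> carrier S" if "x \<in> carrier S" "y \<in> carrier S" for x y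
    using S that by (simp_all add: is_semiring_def)
  have "g \<in> alg_hom S B" "f \<in> alg_hom B S"
    using closed by (auto simp: alg_hom_def B_def)
  moreover have "c \<in> g ` carrier S" for c
    by (rule image_eqI[of c g "f c"]) simp_all
  then have "g ` carrier S = carrier B"
    by (auto simp: B_def)
  moreover have "x \<in> f ` UNIV" if "x \<in> carrier S" for x
    using that by (intro image_eqI[of x f "g x"]) simp_all
  then have "f ` carrier B = carrier S"
    by (auto simp: B_def)
  ultimately have "hom_image S B" "hom_image B S"
    unfolding hom_image_def by blast+
  then have "hom_image B S" and "is_semiring B"
    using S models_hom_image[of semiring_ids S B] by (simp_all add: is_semiring_iff_models)
  then have "models (semiring_ids \<union> sr2_ids) B"
    using bool_semiring_laws[of B] by (simp add: models_sr2_iff B_def)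
  then show ?thesis
    using models_hom_image[OF _ \<open>hom_image B S\<close>] models_sr2_iff by blast
qed

section \<open>The product of all two-element semirings over all valuations\<close>

text \<open>
  Copies of the two truth values inside a type of sets, so that the two-element semirings live in
  the same universe as their product.
\<close>
definition bool_of :: "'s set \<Rightarrow> bool" where
  "bool_of X \<longleftrightarrow> X \<noteq> {}"

definition of_bool_set :: "bool \<Rightarrow> 's set" where
  "of_bool_set b = (if b then UNIV else {})"

lemma bool_of_of_bool_set [simp]: "bool_of (of_bool_set b) = b"
  by (simp add: bool_of_def of_bool_set_def)

lemma of_bool_set_eq_iff [simp]: "of_bool_set b = of_bool_set c \<longleftrightarrow> b = c"
  by (simp add: of_bool_set_def)

lemma tables_semiring:
  assumes "(p, t) \<in> set two_element_tables"
  shows "class.semiring p t"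
proof -
  from assms have "\<forall>x y z. p (p x y) z = p x (p y z) \<and> p x y = p y x \<and> t (t x y) z = t x (t y z)
     \<and> t (p x y) z = p (t x z) (t y z) \<and> t x (p y z) = p (t x y) (t x z)"
    unfolding two_element_tables_def by auto
  then show ?thesis by unfold_locales blast+
qed

definition table_alg :: "(bool \<Rightarrow> bool \<Rightarrow> bool) \<times> (bool \<Rightarrow> bool \<Rightarrow> bool) \<Rightarrow> 's set alg" where
  "table_alg = (\<lambda>(p, t).
     \<lparr>carrier = range of_bool_set,
      plus = (\<lambda>X Y. of_bool_set (p (bool_of X) (bool_of Y))),
      times = (\<lambda>X Y. of_bool_set (t (bool_of X) (bool_of Y)))\<rparr>)"

lemma table_alg_semiring:
  assumes "pt \<in> set two_element_tables"
  shows "is_semiring (table_alg pt :: 's set alg)" and "card (carrier (table_alg pt :: 's set alg)) = 2"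
proof -
  obtain p t where pt: "pt = (p, t)" by (cases pt)
  interpret semiring p t
    using tables_semiring assms by (simp add: pt)
  show "is_semiring (table_alg pt :: 's set alg)"
    by (simp add: is_semiring_def table_alg_def pt add.assoc add.commute add.left_commute
        mult.assoc distrib_left distrib_right)
  have "range of_bool_set = {of_bool_set True, of_bool_set False :: 's set}"
    by (simp add: UNIV_bool insert_commute)
  then show "card (carrier (table_alg pt :: 's set alg)) = 2"
    by (simp add: table_alg_def pt)
qed

text \<open>
  A factor of the product is given by a table and a valuation of the letters \<open>'a\<close>. Both are coded in
  one set \<open>j\<close>: the elements of \<open>'a\<close> in \<open>j\<close> are the letters with value \<open>True\<close>, and the least number in \<open>j\<close>
  selects the table. Reducing modulo 10 makes every set an index, including sets without
  numbers, for which the least number is an unspecified one.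
\<close>
definition table_at :: "('a + nat) set \<Rightarrow> (bool \<Rightarrow> bool \<Rightarrow> bool) \<times> (bool \<Rightarrow> bool \<Rightarrow> bool)" where
  "table_at j = two_element_tables ! ((LEAST n. Inr n \<in> j) mod 10)"

definition valuation_at :: "('a + nat) set \<Rightarrow> 'a \<Rightarrow> bool" where
  "valuation_at j x \<longleftrightarrow> Inl x \<in> j"

lemma length_tables: "length two_element_tables = 10"
  by (simp add: two_element_tables_def)

lemma table_at_in: "table_at j \<in> set two_element_tables"
  unfolding table_at_def by (rule nth_mem) (simp add: length_tables)

lemma index_of_table_and_valuation:
  assumes "pt \<in> set two_element_tables"
  shows "\<exists>j. table_at j = pt \<and> valuation_at j = v"
proof -
  obtain k where k: "k < 10" "two_element_tables ! k = pt"
    using assms by (auto simp: in_set_conv_nth length_tables)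
  let ?j = "Inl ` {x. v x} \<union> {Inr k}"
  have "(LEAST n. Inr n \<in> ?j) = k"
    by (rule Least_equality) auto
  then have "table_at ?j = pt" using k by (simp add: table_at_def)
  moreover have "valuation_at ?j = v" by (auto simp: valuation_at_def)
  ultimately show ?thesis by blast
qed

text \<open>
  An element of the product is identified with the set of indices at which it is \<open>True\<close>. The carrier of
  the product is therefore the whole type \<open>('a + nat) set set\<close>.
\<close>
definition table_product :: "('a + nat) set set alg" where
  "table_product = \<lparr>carrier = UNIV,
     plus = (\<lambda>X Y. {j. fst (table_at j) (j \<in> X) (j \<in> Y)}),
     times = (\<lambda>X Y. {j. snd (table_at j) (j \<in> X) (j \<in> Y)})\<rparr>"

lemma table_product_in_variety:
  fixes V :: "('a + nat) set set alg set"
  assumes V: "variety V" and two: "{A. is_semiring A \<and> card (carrier A) = 2} \<subseteq> V"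
  shows "table_product \<in> V"
proof -
  \<comment> \<open>Varieties index products by subsets of the universe, hence the singletons instead of the indices.\<close>
  define I :: "('a + nat) set set set" where "I = range (\<lambda>j. {j})"
  define F :: "('a + nat) set set \<Rightarrow> ('a + nat) set set alg"
    where "F = (\<lambda>i. table_alg (table_at (the_elem i)))"
  define f where "f = (\<lambda>g. {j :: ('a + nat) set. bool_of (g {j} :: ('a + nat) set set)})"
  have F: "F i \<in> V" for i
    using two table_alg_semiring[OF table_at_in] unfolding F_def by blast
  have carr: "carrier (direct_product I F) = (\<Pi>\<^sub>E i\<in>I. range of_bool_set)"
    by (simp add: direct_product_def F_def table_alg_def case_prod_beta)
  have hom: "f \<in> alg_hom (direct_product I F) table_product"
    by (simp add: alg_hom_def f_def direct_product_def F_def table_alg_def table_product_def I_def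
        case_prod_beta)
  have bij: "bij_betw f (carrier (direct_product I F)) (carrier table_product)"
  proof (rule bij_betw_byWitness[where f' = "\<lambda>X. \<lambda>i\<in>I. of_bool_set (the_elem i \<in> X)"])
    show "\<forall>g\<in>carrier (direct_product I F). (\<lambda>i\<in>I. of_bool_set (the_elem i \<in> f g)) = g"
    proof
      fix g assume g: "g \<in> carrier (direct_product I F)"
      show "(\<lambda>i\<in>I. of_bool_set (the_elem i \<in> f g)) = g"
      proof
        fix i
        show "(\<lambda>i\<in>I. of_bool_set (the_elem i \<in> f g)) i = g i"
        proof (cases "i \<in> I")
          case True
          then have "g i \<in> range of_bool_set"
            using g PiE_mem[of g I "\<lambda>i. range of_bool_set" i] by (simp only: carr)
          then have "of_bool_set (bool_of (g i)) = g i"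
            by (elim rangeE) simp
          moreover obtain j where "i = {j}" using True by (auto simp: I_def)
          ultimately show ?thesis using True by (simp add: f_def)
        next
          case False
          then show ?thesis
            using PiE_arb[OF g[unfolded carr] False] by simp
        qed
      qed
    qed
    show "\<forall>X\<in>carrier table_product. f (\<lambda>i\<in>I. of_bool_set (the_elem i \<in> X)) = X"
      by (simp add: f_def I_def)
  qed (auto simp: carr table_product_def)
  have "alg_iso (direct_product I F) (table_product :: ('a + nat) set set alg)"
    unfolding alg_iso_def using hom bij by (intro bexI[of _ f])
  then show ?thesis
    using V F unfolding variety_def by blast
qed

definition term_function :: "'a poly \<Rightarrow> ('a + nat) set set" where
  "term_function P =
     {j. poly_value (fst (table_at j)) (snd (table_at j)) (valuation_at j) P}"

lemma term_function_hom:
  fixes P Q :: "'a poly"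
  assumes "is_poly P" "is_poly Q"
  shows "term_function (P @ Q) = term_function P \<oplus>\<^bsub>table_product\<^esub> term_function Q"
    and "term_function (poly_mult P Q) = term_function P \<otimes>\<^bsub>table_product\<^esub> term_function Q"
proof -
  have table: "class.semiring (fst (table_at j)) (snd (table_at j))" for j :: "('a + nat) set"
    using table_at_in[of j] by (intro tables_semiring) simp
  show "term_function (P @ Q) = term_function P \<oplus>\<^bsub>table_product\<^esub> term_function Q"
    "term_function (poly_mult P Q) = term_function P \<otimes>\<^bsub>table_product\<^esub> term_function Q"
    by (simp_all add: term_function_def table_product_def semiring.poly_value_append[OF table assms]
        semiring.poly_value_mult[OF table assms])
qed

lemma term_function_eqD:
  fixes P Q :: "'a poly"
  assumes "term_function P = term_function Q"
  shows "equal_on_tables P Q"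
  unfolding equal_on_tables_def
proof (clarify)
  fix p t and v :: "'a \<Rightarrow> bool" assume "(p, t) \<in> set two_element_tables"
  then obtain j where "table_at j = (p, t)" "valuation_at j = v"
    using index_of_table_and_valuation by blast
  then show "poly_value p t v P = poly_value p t v Q"
    using assms by (auto simp: term_function_def set_eq_iff dest: spec[of _ j])
qed

section \<open>The two inclusions\<close>

text \<open>
  The elements of \<open>S\<close> serve as letters. The term functions of polynomials over \<open>S\<close> form a subalgebra of
  the product of two-element semirings, and sending a term function to the value of its polynomial in
  \<open>S\<close> is well defined by completeness; it is a homomorphism onto a copy of \<open>S\<close> in the universe.
\<close>
lemma sr2_laws_imp_Sr2:
  fixes S :: "'a alg"
  assumes S: "is_semiring S" and laws: "sr2_laws S"
  shows "S \<in> Sr2"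
proof -
  let ?C = "carrier S"
  have closed [simp]: "x \<in> ?C \<Longrightarrow> y \<in> ?C \<Longrightarrow> x \<oplus>\<^bsub>S\<^esub> y \<in> ?C" "x \<in> ?C \<Longrightarrow> y \<in> ?C \<Longrightarrow> x \<otimes>\<^bsub>S\<^esub> y \<in> ?C" for x y
    using S by (simp_all add: is_semiring_def)
  obtain c where c: "c \<in> ?C" using S by (auto simp: is_semiring_def)
  \<comment> \<open>Retracting all arguments to the carrier extends the operations to the whole type. No side of a
      law is a bare variable, so the extended operations satisfy the laws everywhere.\<close>
  define r where "r x = (if x \<in> ?C then x else c)" for x
  have r [simp]: "r x \<in> ?C" "x \<in> ?C \<Longrightarrow> r x = x" for x
    using c by (simp_all add: r_def)
  define p where "p x y = r x \<oplus>\<^bsub>S\<^esub> r y" for x y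
  define t where "t x y = r x \<otimes>\<^bsub>S\<^esub> r y" for x y
  have comm: "x \<oplus>\<^bsub>S\<^esub> y = y \<oplus>\<^bsub>S\<^esub> x" if "x \<in> ?C" "y \<in> ?C" for x y
    using S that unfolding is_semiring_def by blast
  have ring: "x \<oplus>\<^bsub>S\<^esub> y \<oplus>\<^bsub>S\<^esub> z = x \<oplus>\<^bsub>S\<^esub> (y \<oplus>\<^bsub>S\<^esub> z)" "x \<otimes>\<^bsub>S\<^esub> y \<otimes>\<^bsub>S\<^esub> z = x \<otimes>\<^bsub>S\<^esub> (y \<otimes>\<^bsub>S\<^esub> z)"
    "x \<otimes>\<^bsub>S\<^esub> (y \<oplus>\<^bsub>S\<^esub> z) = x \<otimes>\<^bsub>S\<^esub> y \<oplus>\<^bsub>S\<^esub> x \<otimes>\<^bsub>S\<^esub> z"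
    "(y \<oplus>\<^bsub>S\<^esub> z) \<otimes>\<^bsub>S\<^esub> x = y \<otimes>\<^bsub>S\<^esub> x \<oplus>\<^bsub>S\<^esub> z \<otimes>\<^bsub>S\<^esub> x" if "x \<in> ?C" "y \<in> ?C" "z \<in> ?C" for x y z
    using S that unfolding is_semiring_def by blast+
  have sr: "class.semiring p t"
  proof
    show "p x y = p y x" for x y
      unfolding p_def by (intro comm r)
  qed (simp_all add: p_def t_def ring)
  interpret sr2 p t
  proof (intro class.sr2.intro sr class.sr2_axioms.intro; simp only: p_def t_def r closed)
  qed (metis laws[unfolded sr2_laws_def] r(1))+
  let ?val = "poly_value p t id"
  define Pol where "Pol = {P. is_poly P \<and> (\<forall>w\<in>set P. set w \<subseteq> ?C)}"
  have PolD: "is_poly P" if "P \<in> Pol" for P using that by (simp add: Pol_def)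
  have Pol_append: "P @ Q \<in> Pol" "poly_mult P Q \<in> Pol" if "P \<in> Pol" "Q \<in> Pol" for P Q
  proof -
    show "P @ Q \<in> Pol"
      using that by (auto simp: Pol_def is_poly_append)
    have "set w \<subseteq> ?C" if w: "w \<in> set (poly_mult P Q)" for w
    proof -
      obtain a b where "a \<in> set P" "b \<in> set Q" "w = a @ b"
        using w by (auto simp: poly_mult_def)
      then show ?thesis
        using \<open>P \<in> Pol\<close> \<open>Q \<in> Pol\<close> by (simp add: Pol_def)
    qed
    then show "poly_mult P Q \<in> Pol"
      using that by (simp add: Pol_def is_poly_mult)
  qed
  have val: "?val P \<in> ?C" if "P \<in> Pol" for P
  proof -
    have "fold1 t w \<in> ?C" if "w \<in> set P" for w
      using that \<open>P \<in> Pol\<close> by (intro fold1_closed) (auto simp: t_def Pol_def is_poly_def)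
    then show ?thesis
      unfolding poly_value_def using PolD[OF that] by (intro fold1_closed) (auto simp: p_def is_poly_def)
  qed
  have val_hom: "?val (P @ Q) = ?val P \<oplus>\<^bsub>S\<^esub> ?val Q" "?val (poly_mult P Q) = ?val P \<otimes>\<^bsub>S\<^esub> ?val Q"
    if "P \<in> Pol" "Q \<in> Pol" for P Q
    using that by (simp_all add: poly_value_append poly_value_mult PolD val p_def[of "?val P"] t_def[of "?val P"])
  define H where "H = term_function ` Pol"
  define e where "e x = {{Inl x :: 'a + nat}}" for x
  have inj_e: "inj e" by (auto simp: e_def inj_def)
  define T where "T = \<lparr>carrier = e ` ?C, plus = (\<lambda>X Y. e (inv e X \<oplus>\<^bsub>S\<^esub> inv e Y)),
    times = (\<lambda>X Y. e (inv e X \<otimes>\<^bsub>S\<^esub> inv e Y))\<rparr>"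
  define h where "h X = e (?val (SOME P. P \<in> Pol \<and> term_function P = X))" for X
  have h: "h (term_function P) = e (?val P)" if "P \<in> Pol" for P
  proof -
    let ?Q = "SOME Q. Q \<in> Pol \<and> term_function Q = term_function P"
    have "?Q \<in> Pol \<and> term_function ?Q = term_function P"
      using that by (intro someI[of "\<lambda>Q. Q \<in> Pol \<and> term_function Q = term_function P" P]) simp
    then have "?val ?Q = ?val P"
      using that by (intro equal_on_tables_imp_eq term_function_eqD PolD) auto
    then show ?thesis by (simp add: h_def)
  qed
  have letter: "[[x]] \<in> Pol" "?val [[x]] = x" if "x \<in> ?C" for x
    using that by (simp_all add: Pol_def is_poly_def poly_value_def)
  have "T \<in> V" if V: "variety V"
    and two: "{A :: ('a + nat) set set alg. is_semiring A \<and> card (carrier A) = 2} \<subseteq> V" for V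
  proof -
    have "subuniverse H table_product"
      using letter(1)[OF c] Pol_append
      by (auto simp: subuniverse_def H_def term_function_hom[symmetric] PolD table_product_def[THEN arg_cong[where f = carrier]])
    then have HV: "table_product\<lparr>carrier := H\<rparr> \<in> V"
      using V table_product_in_variety[OF V two] unfolding variety_def by blast
    have "h \<in> alg_hom (table_product\<lparr>carrier := H\<rparr>) T"
      using inj_e val by (auto simp: alg_hom_def H_def T_def h Pol_append val_hom PolD
          term_function_hom[symmetric])
    moreover have "h ` H = e ` ?C"
    proof
      show "h ` H \<subseteq> e ` ?C" using h val by (auto simp: H_def)
      show "e ` ?C \<subseteq> h ` H"
        using h[OF letter(1)] letter by (force simp: H_def image_iff)
    qed
    ultimately have "hom_image (table_product\<lparr>carrier := H\<rparr>) T"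
      by (auto simp: hom_image_def T_def)
    then show "T \<in> V"
      using V HV unfolding variety_def by blast
  qed
  then have "T \<in> variety_generated_by {A. is_semiring A \<and> card (carrier A) = 2}"
    by (auto simp: variety_generated_by_def)
  moreover have "alg_iso T S"
    unfolding alg_iso_def
  proof
    show "inv e \<in> alg_hom T S"
      using inj_e by (auto simp: alg_hom_def T_def)
    show "bij_betw (inv e) (carrier T) (carrier S)"
      using inj_e by (auto simp: T_def bij_betw_def inj_on_def image_image)
  qed
  ultimately show ?thesis
    by (auto simp: Sr2_def)
qed

lemma Sr2_imp_sr2_laws:
  fixes S :: "'a alg"
  assumes "S \<in> Sr2"
  shows "is_semiring S \<and> sr2_laws S"
proof -
  let ?V = "{A :: ('a + nat) set set alg. models (semiring_ids \<union> sr2_ids) A}"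
  obtain T where T: "T \<in> variety_generated_by {A :: ('a + nat) set set alg. is_semiring A \<and> card (carrier A) = 2}"
    and iso: "alg_iso T S"
    using assms by (auto simp: Sr2_def)
  have "variety ?V" by (rule variety_models) simp
  moreover have "{A. is_semiring A \<and> card (carrier A) = 2} \<subseteq> ?V"
    using two_element_laws by (auto simp: models_sr2_iff)
  ultimately have "T \<in> ?V"
    using T by (auto simp: variety_generated_by_def)
  then show ?thesis
    using models_hom_image[OF _ hom_image_of_alg_iso[OF iso]] models_sr2_iff by blast
qed

theorem theorem3p1:
  "(Sr2 :: 'a alg set) =
     {S. is_semiring S \<and>
       (\<forall>x\<in>carrier S. \<forall>y\<in>carrier S. x \<otimes>\<^bsub>S\<^esub> x \<otimes>\<^bsub>S\<^esub> y = x \<otimes>\<^bsub>S\<^esub> y) \<and>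
       (\<forall>x\<in>carrier S. \<forall>y\<in>carrier S. x \<otimes>\<^bsub>S\<^esub> y \<otimes>\<^bsub>S\<^esub> y = x \<otimes>\<^bsub>S\<^esub> y) \<and>
       (\<forall>x\<in>carrier S. \<forall>y\<in>carrier S. \<forall>z\<in>carrier S. \<forall>t\<in>carrier S.
          x \<otimes>\<^bsub>S\<^esub> y \<otimes>\<^bsub>S\<^esub> z \<otimes>\<^bsub>S\<^esub> t = x \<otimes>\<^bsub>S\<^esub> z \<otimes>\<^bsub>S\<^esub> y \<otimes>\<^bsub>S\<^esub> t) \<and>
       (\<forall>x\<in>carrier S. \<forall>y\<in>carrier S. (x \<otimes>\<^bsub>S\<^esub> y) \<otimes>\<^bsub>S\<^esub> (x \<otimes>\<^bsub>S\<^esub> y) = x \<otimes>\<^bsub>S\<^esub> y) \<and>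
       (\<forall>x\<in>carrier S. \<forall>y\<in>carrier S. \<forall>z\<in>carrier S.
          x \<oplus>\<^bsub>S\<^esub> y \<otimes>\<^bsub>S\<^esub> z = x \<oplus>\<^bsub>S\<^esub> y \<otimes>\<^bsub>S\<^esub> z \<oplus>\<^bsub>S\<^esub> (x \<otimes>\<^bsub>S\<^esub> z \<oplus>\<^bsub>S\<^esub> x \<otimes>\<^bsub>S\<^esub> z)) \<and>
       (\<forall>x\<in>carrier S. \<forall>y\<in>carrier S. \<forall>z\<in>carrier S.
          x \<oplus>\<^bsub>S\<^esub> y \<otimes>\<^bsub>S\<^esub> z = x \<oplus>\<^bsub>S\<^esub> y \<otimes>\<^bsub>S\<^esub> z \<oplus>\<^bsub>S\<^esub> (y \<otimes>\<^bsub>S\<^esub> x \<oplus>\<^bsub>S\<^esub> y \<otimes>\<^bsub>S\<^esub> x)) \<and>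
       (\<forall>x\<in>carrier S. \<forall>y\<in>carrier S. \<forall>z\<in>carrier S.
          x \<oplus>\<^bsub>S\<^esub> y \<otimes>\<^bsub>S\<^esub> z = x \<oplus>\<^bsub>S\<^esub> y \<otimes>\<^bsub>S\<^esub> z \<oplus>\<^bsub>S\<^esub> (x \<otimes>\<^bsub>S\<^esub> x \<oplus>\<^bsub>S\<^esub> x \<otimes>\<^bsub>S\<^esub> x)) \<and>
       (\<forall>x\<in>carrier S. \<forall>y\<in>carrier S. \<forall>z\<in>carrier S.
          x \<oplus>\<^bsub>S\<^esub> y \<otimes>\<^bsub>S\<^esub> z = x \<oplus>\<^bsub>S\<^esub> y \<otimes>\<^bsub>S\<^esub> z \<oplus>\<^bsub>S\<^esub> (x \<otimes>\<^bsub>S\<^esub> y \<otimes>\<^bsub>S\<^esub> z \<oplus>\<^bsub>S\<^esub> x \<otimes>\<^bsub>S\<^esub> y \<otimes>\<^bsub>S\<^esub> z)) \<and>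
       (\<forall>x\<in>carrier S. \<forall>y\<in>carrier S. \<forall>z\<in>carrier S.
          x \<oplus>\<^bsub>S\<^esub> y \<otimes>\<^bsub>S\<^esub> z = x \<oplus>\<^bsub>S\<^esub> y \<otimes>\<^bsub>S\<^esub> z \<oplus>\<^bsub>S\<^esub> (y \<otimes>\<^bsub>S\<^esub> z \<otimes>\<^bsub>S\<^esub> x \<oplus>\<^bsub>S\<^esub> y \<otimes>\<^bsub>S\<^esub> z \<otimes>\<^bsub>S\<^esub> x)) \<and>
       (\<forall>x\<in>carrier S. \<forall>y\<in>carrier S. x \<oplus>\<^bsub>S\<^esub> y = x \<oplus>\<^bsub>S\<^esub> (y \<oplus>\<^bsub>S\<^esub> y \<oplus>\<^bsub>S\<^esub> y))}"
proof -
  have "Sr2 = {S :: 'a alg. is_semiring S \<and> sr2_laws S}"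
    using Sr2_imp_sr2_laws sr2_laws_imp_Sr2 by blast
  then show ?thesis
    unfolding sr2_laws_def .
qed

end
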